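(* Define integers $c(n)$ by $\sum_{n\ge 0}c(n)q^n=\frac{E_5^4}{E_1}$, and for $\alpha\ge1$ let $\tilde{\delta}_\alpha=\frac{23\cdot 5^{\alpha}-19}{24}$ if $\alpha$ is odd and $\tilde{\delta}_\alpha=\frac{19(5^{\alpha}-1)}{24}$ if $\alpha$ is even. Let $M=(m_{i,j})_{i,j\ge1}$, $\tilde A=(\tilde a_{i,j})$, $\tilde B=(\tilde b_{i,j})$ and the row vectors $\tilde{\mathbf x}_\alpha=(\tilde x_{\alpha,1},\tilde x_{\alpha,2},\dots)$ be as defined in the context. Then for every $\alpha\ge1$, \[ \sum_{n=0}^\infty c\left(5^\alpha n+\tilde{\delta}_\alpha\right)q^n=\sum_{i \geq 1} \tilde{x}_{\alpha, i}\, q^{i-1} \frac{E_5^{6 i-1}}{E_1^{6 i-4}}\quad\text{if $\alpha$ is odd,} \] \[ \sum_{n=0}^\infty c\left(5^\alpha n+\tilde{\delta}_\alpha\right)q^n=\sum_{i \geq 1} \tilde{x}_{\alpha, i}\, q^{i-1} \frac{E_5^{6 i-2}}{E_1^{6 i-5}}\quad\text{if $\alpha$ is even.} \]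
   Context: $E_j:=\prod_{n\ge1}(1-q^{jn})$. The matrix $M=(m_{i,j})_{i,j\ge1}$ has first five rows $(5,0,0,0,0,0,\dots)$, $(2\cdot5,\,5^3,0,0,0,0,\dots)$, $(9,\,3\cdot5^3,\,5^5,0,0,0,\dots)$, $(4,\,22\cdot5^2,\,4\cdot5^5,\,5^7,0,0,\dots)$, $(1,\,4\cdot5^3,\,8\cdot5^5,\,5^8,\,5^9,0,\dots)$; for $i\ge6$, $m_{i,1}=0$ and for $j\ge2$, $m_{i,j}=25m_{i-1,j-1}+25m_{i-2,j-1}+15m_{i-3,j-1}+5m_{i-4,j-1}+m_{i-5,j-1}$. Define $\tilde a_{i,j}=m_{6i-4,\,i-1+j}$ and $\tilde b_{i,j}=m_{6i-5,\,i-1+j}$ for $i,j\ge1$. Define $\tilde{\mathbf x}_1=(5,0,0,\dots)$ and, for $\alpha\ge1$, $\tilde{\mathbf x}_{\alpha+1}=\tilde{\mathbf x}_\alpha\tilde A$ if $\alpha$ is odd and $\tilde{\mathbf x}_{\alpha+1}=\tilde{\mathbf x}_\alpha\tilde B$ if $\alpha$ is even (row vector times matrix, i.e. $\tilde x_{\alpha+1,j}=\sum_{i\ge1}\tilde x_{\alpha,i}\tilde a_{i,j}$ resp. $\sum_i\tilde x_{\alpha,i}\tilde b_{i,j}$). (One also has $c(n)=NT(4,5,5n+4)-NT(1,5,5n+4)$, where $NT(m,k,n)$ is the total number of parts in partitions of $n$ with rank $\equiv m\pmod k$.) *)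

theory Defs
  imports "HOL-Analysis.Analysis"
begin

unbundle no vec_syntax
unbundle fps_syntax

text \<open>Identities of \<open>q\<close>-series are identities of formal power series over the rationals, with
  \<open>q\<close> being \<^const>\<open>fps_X\<close>; limits, infinite products and infinite sums refer to the
  \<open>X\<close>-adic topology.\<close>

definition E :: "nat \<Rightarrow> rat fps" where
  "E j = (\<Prod>n. 1 - fps_X ^ (j * Suc n))"

text \<open>All matrices and vectors are indexed from 1; entries with an index 0 are set to 0.\<close>

definition M_rows :: "int list list" where
  "M_rows =
    [[5],
     [2 * 5, 5 ^ 3],
     [9, 3 * 5 ^ 3, 5 ^ 5],
     [4, 22 * 5 ^ 2, 4 * 5 ^ 5, 5 ^ 7],
     [1, 4 * 5 ^ 3, 8 * 5 ^ 5, 5 ^ 8, 5 ^ 9]]"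

fun M :: "nat \<Rightarrow> nat \<Rightarrow> int" where
  "M i j =
    (if i = 0 \<or> j = 0 then 0
     else if i \<le> 5 then
       (if j \<le> length (M_rows ! (i - 1)) then M_rows ! (i - 1) ! (j - 1) else 0)
     else if j = 1 then 0
     else 25 * M (i - 1) (j - 1) + 25 * M (i - 2) (j - 1) + 15 * M (i - 3) (j - 1)
          + 5 * M (i - 4) (j - 1) + M (i - 5) (j - 1))"

declare M.simps [simp del]

definition a_tilde :: "nat \<Rightarrow> nat \<Rightarrow> int" where
  "a_tilde i j = (if i \<ge> 1 \<and> j \<ge> 1 then M (6 * i - 4) (i - 1 + j) else 0)"

definition b_tilde :: "nat \<Rightarrow> nat \<Rightarrow> int" where
  "b_tilde i j = (if i \<ge> 1 \<and> j \<ge> 1 then M (6 * i - 5) (i - 1 + j) else 0)"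

text \<open>Only finitely many terms of the sum are nonzero for the vectors \<open>x_tilde \<alpha>\<close> below.\<close>

definition vec_mat_mult :: "(nat \<Rightarrow> int) \<Rightarrow> (nat \<Rightarrow> nat \<Rightarrow> int) \<Rightarrow> nat \<Rightarrow> int" where
  "vec_mat_mult v A j = (\<Sum>\<^sub>\<infinity>i\<in>{1..}. v i * A i j)"

fun x_tilde :: "nat \<Rightarrow> nat \<Rightarrow> int" where
  "x_tilde 0 = (\<lambda>j. 0)"
| "x_tilde (Suc 0) = (\<lambda>j. if j = 1 then 5 else 0)"
| "x_tilde (Suc (Suc \<alpha>)) =
    vec_mat_mult (x_tilde (Suc \<alpha>)) (if odd (Suc \<alpha>) then a_tilde else b_tilde)"

text \<open>Both divisions are exact and the subtractions are not truncated; see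
  \<open>delta_tilde_odd\<close> and \<open>delta_tilde_even\<close>.\<close>

definition delta_tilde :: "nat \<Rightarrow> nat" where
  "delta_tilde \<alpha> =
    (if odd \<alpha> then (23 * 5 ^ \<alpha> - 19) div 24 else 19 * (5 ^ \<alpha> - 1) div 24)"

lemma pow25_mod_24: "(25 ^ k :: nat) mod 24 = 1"
  using power_mod [of "25 :: nat" 24 k] by simp

lemma delta_tilde_odd:
  assumes "odd \<alpha>"
  shows "real (delta_tilde \<alpha>) = (23 * 5 ^ \<alpha> - 19) / 24"
proof -
  from assms obtain k where k: "\<alpha> = 2 * k + 1"
    by (elim oddE)
  obtain t where t: "(25 ^ k :: nat) = 24 * t + 1"
    using pow25_mod_24 [of k] by (metis mult_div_mod_eq)
  have eq: "(5 ^ \<alpha> :: nat) = 5 * (24 * t + 1)"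
    using t by (simp add: k power_mult)
  have "delta_tilde \<alpha> = 115 * t + 4"
    unfolding delta_tilde_def eq using assms by simp
  moreover have "(5 ^ \<alpha> :: real) = 5 * (24 * real t + 1)"
    using arg_cong [OF eq, of real] by simp
  ultimately show ?thesis
    by simp
qed

lemma delta_tilde_even:
  assumes "even \<alpha>"
  shows "real (delta_tilde \<alpha>) = 19 * (5 ^ \<alpha> - 1) / 24"
proof -
  from assms obtain k where k: "\<alpha> = 2 * k"
    by (elim evenE)
  obtain t where t: "(25 ^ k :: nat) = 24 * t + 1"
    using pow25_mod_24 [of k] by (metis mult_div_mod_eq)
  have eq: "(5 ^ \<alpha> :: nat) = 24 * t + 1"
    using t by (simp add: k power_mult)
  have "delta_tilde \<alpha> = 19 * t"
    unfolding delta_tilde_def eq using assms by simp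
  moreover have "(5 ^ \<alpha> :: real) = 24 * real t + 1"
    using arg_cong [OF eq, of real] by simp
  ultimately show ?thesis
    by simp
qed

text \<open>The infinite product defining \<open>E j\<close> converges, and \<open>E 5 ^ 4 / E 1\<close> has integer
  coefficients.\<close>

lemma E_partial_nth:
  assumes "j \<ge> 1" "n \<le> N"
  shows "(\<Prod>i\<le>N. 1 - fps_X ^ (j * Suc i) :: rat fps) $ n
       = (\<Prod>i\<le>n. 1 - fps_X ^ (j * Suc i)) $ n"
  using assms(2)
proof (induction N rule: dec_induct)
  case base
  show ?case ..
next
  case (step N)
  have "n < j * Suc (Suc N)"
    using step.hyps assms(1) by (metis less_Suc_eq_le mult_le_mono1 mult_1 le_less_trans lessI
        less_le_trans le_SucI)
  then show ?case
    using step.IH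
    by (simp add: right_diff_distrib fps_X_power_mult_right_nth del: mult_Suc_right)
qed

lemma E_has_prod:
  assumes "j \<ge> 1"
  shows "(\<lambda>n. 1 - fps_X ^ (j * Suc n) :: rat fps) has_prod E j"
    and "E j $ n = (\<Prod>i\<le>n. 1 - fps_X ^ (j * Suc i)) $ n"
proof -
  define P :: "rat fps" where "P = Abs_fps (\<lambda>n. (\<Prod>i\<le>n. 1 - fps_X ^ (j * Suc i)) $ n)"
  have "P $ 0 = 1"
    using assms by (simp add: P_def)
  then have "P \<noteq> 0"
    by auto
  moreover have "(\<lambda>N. \<Prod>i\<le>N. 1 - fps_X ^ (j * Suc (i + 0)) :: rat fps) \<longlonglongrightarrow> P"
  proof (rule tendsto_fpsI)
    fix n
    show "\<forall>\<^sub>F N in sequentially. (\<Prod>i\<le>N. 1 - fps_X ^ (j * Suc (i + 0)) :: rat fps) $ n = P $ n"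
      using eventually_ge_at_top [of n]
      by eventually_elim (unfold P_def fps_nth_Abs_fps add_0_right, rule E_partial_nth [OF assms])
  qed
  ultimately have *: "(\<lambda>n. 1 - fps_X ^ (j * Suc n) :: rat fps) has_prod P"
    unfolding has_prod_def raw_has_prod_def by blast
  have "prodinf (\<lambda>n. 1 - fps_X ^ (j * Suc n) :: rat fps) = P"
    unfolding prodinf_def
  proof (rule the_equality)
    show "(\<lambda>n. 1 - fps_X ^ (j * Suc n) :: rat fps) has_prod P"
      by (fact *)
  next
    fix Q :: "rat fps"
    assume Q: "(\<lambda>n. 1 - fps_X ^ (j * Suc n)) has_prod Q"
    have "1 - fps_X ^ (j * Suc n) \<noteq> (0 :: rat fps)" for n
    proof
      assume "1 - fps_X ^ (j * Suc n) = (0 :: rat fps)"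
      from arg_cong [OF this, of "\<lambda>f. f $ 0"] assms show False
        by simp
    qed
    with Q * show "Q = P"
      unfolding has_prod_def raw_has_prod_def by (metis LIMSEQ_unique)
  qed
  then have "E j = P"
    by (simp add: E_def)
  with * show "(\<lambda>n. 1 - fps_X ^ (j * Suc n) :: rat fps) has_prod E j"
    and "E j $ n = (\<Prod>i\<le>n. 1 - fps_X ^ (j * Suc i)) $ n"
    by (simp_all add: P_def)
qed

definition int_fps :: "rat fps \<Rightarrow> bool" where
  "int_fps f \<longleftrightarrow> (\<forall>n. f $ n \<in> \<int>)"

lemma int_fps_mult: "int_fps f \<Longrightarrow> int_fps g \<Longrightarrow> int_fps (f * g)"
  by (auto simp: int_fps_def fps_mult_nth intro: Ints_mult)

lemma int_fps_prod: "finite S \<Longrightarrow> (\<And>i. i \<in> S \<Longrightarrow> int_fps (f i)) \<Longrightarrow> int_fps (prod f S)"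
proof (induction S rule: finite_induct)
  case empty
  then show ?case
    by (simp add: int_fps_def)
next
  case (insert x S)
  then show ?case
    by (simp add: int_fps_mult)
qed

lemma int_fps_inverse:
  assumes "int_fps f" "f $ 0 = 1"
  shows "int_fps (inverse f)"
proof -
  have "inverse f $ n \<in> \<int>" for n
  proof (induction n rule: less_induct)
    case (less n)
    show ?case
    proof (cases n)
      case 0
      then show ?thesis
        using assms by simp
    next
      case (Suc k)
      have "inverse f $ n = - (\<Sum>i=1..n. f $ i * inverse f $ (n - i))"
        using assms(2) Suc by (simp add: fps_inverse_def)
      also have "\<dots> \<in> \<int>"
      proof (intro Ints_minus Ints_sum Ints_mult)
        fix i
        assume "i \<in> {1..n}"
        then show "inverse f $ (n - i) \<in> \<int>"
          using Suc by (intro less.IH) auto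
      qed (use assms(1) in \<open>simp add: int_fps_def\<close>)
      finally show ?thesis .
    qed
  qed
  then show ?thesis
    by (simp add: int_fps_def)
qed

lemma int_fps_E:
  assumes "j \<ge> 1"
  shows "int_fps (E j)"
proof -
  have "int_fps (1 - fps_X ^ k)" for k
    by (simp add: int_fps_def)
  then have "int_fps (\<Prod>i\<le>n. 1 - fps_X ^ (j * Suc i))" for n
    by (intro int_fps_prod) auto
  then show ?thesis
    using E_has_prod(2) [OF assms] by (simp add: int_fps_def)
qed

lemma c_exists_unique: "\<exists>!c :: nat \<Rightarrow> int. Abs_fps (\<lambda>n. of_int (c n)) = E 5 ^ 4 / E 1"
proof -
  have E0: "E 1 $ 0 = 1"
    by (simp add: E_has_prod(2))
  have "int_fps (E 5 ^ 4)"
    using int_fps_E [of 5] by (simp add: eval_nat_numeral int_fps_mult)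
  then have "int_fps (E 5 ^ 4 * inverse (E 1))"
    by (intro int_fps_mult int_fps_inverse int_fps_E E0) simp_all
  then have "int_fps (E 5 ^ 4 / E 1)"
    using E0 by (simp add: fps_divide_unit)
  then have "\<forall>n. \<exists>k :: int. of_int k = (E 5 ^ 4 / E 1) $ n"
    by (metis int_fps_def Ints_cases)
  then obtain c :: "nat \<Rightarrow> int" where c: "\<And>n. of_int (c n) = (E 5 ^ 4 / E 1) $ n"
    by metis
  show ?thesis
  proof (rule ex1I [of _ c])
    show "Abs_fps (\<lambda>n. of_int (c n)) = E 5 ^ 4 / E 1"
      by (simp add: c fps_eq_iff)
  next
    fix d :: "nat \<Rightarrow> int"
    assume "Abs_fps (\<lambda>n. of_int (d n)) = E 5 ^ 4 / E 1"
    then have "of_int (d n) = (of_int (c n) :: rat)" for n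
      by (metis c fps_nth_Abs_fps)
    then show "d = c"
      by auto
  qed
qed

end

theory Submission
  imports Defs "HOL-Computational_Algebra.Formal_Laurent_Series"
begin

text \<open>Put \<open>\<zeta> = E 1 / (X * E 25)\<close>. The 5-dissection of \<open>E 1\<close>, obtained from the pentagonal number
  theorem and the fact that \<open>E 1 ^ 3\<close> has only triangular exponents, reads \<open>\<zeta> = 1 / x - 1 - x\<close>,
  where \<open>x\<close> is \<open>X\<close> times a series in \<open>X ^ 5\<close>. Hence
  \<open>\<zeta>^5 + 5 \<zeta>^4 + 15 \<zeta>^3 + 25 \<zeta>^2 + 25 \<zeta> = 1 / x^5 - 11 - x^5\<close> is the product of the conjugates
  of \<open>\<zeta>\<close> under \<open>X \<mapsto> w X\<close> for the fifth roots of unity \<open>w\<close>, and that product is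
  \<open>E 5 ^ 6 / (X ^ 5 * E 25 ^ 6)\<close> factor by factor. Dividing the equation by powers of \<open>\<zeta>\<close> and
  extracting the exponents divisible by 5 turns it into the recursion defining \<open>M\<close>; the first
  rows of \<open>M\<close> come from the constant terms of \<open>1, \<zeta>, \<dots>, \<zeta>^4\<close> in \<open>x\<close>. Each step from \<open>\<alpha>\<close> to
  \<open>\<alpha> + 1\<close> writes the series at hand in powers of \<open>1 / \<zeta>\<close> times series in \<open>X ^ 5\<close>.\<close>

section \<open>The pentagonal number theorem\<close>

lemma tri_Suc: "Suc k * Suc (Suc k) div 2 = k * Suc k div 2 + Suc k"
proof -
  have "Suc k * Suc (Suc k) = k * Suc k + Suc k * 2"
    by (simp add: algebra_simps)
  then show ?thesis
    by simp
qed

text \<open>The finite form of the pentagonal number theorem is due to Shanks. The exponents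
  \<open>k (3 k - 1) / 2\<close> and \<open>k (3 k + 1) / 2\<close> appear as \<open>k (k + 1) / 2 + k (k - 1)\<close> plus \<open>0\<close> resp.
  \<open>k\<close>.\<close>

definition shanks_term :: "'a::comm_ring_1 \<Rightarrow> nat \<Rightarrow> nat \<Rightarrow> 'a" where
  "shanks_term q n k = (- 1) ^ k * q ^ (k * Suc k div 2 + k * n) * (\<Prod>i=k..<n. 1 - q ^ Suc i)"

lemma shanks_term_Suc:
  assumes "k \<le> n"
  shows "shanks_term q (Suc n) k = q ^ k * (1 - q ^ Suc n) * shanks_term q n k"
  using assms by (simp add: shanks_term_def power_add algebra_simps)

lemma shanks_term_shift:
  assumes "k < n"
  shows "(1 - q ^ Suc k) * shanks_term q n (Suc k) = - (q ^ (k + Suc n) * shanks_term q n k)"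
proof -
  have *: "(\<Prod>i=k..<n. 1 - q ^ Suc i) = (1 - q ^ Suc k) * (\<Prod>i=Suc k..<n. 1 - q ^ Suc i)"
    using assms by (rule prod.atLeast_Suc_lessThan)
  show ?thesis
    unfolding shanks_term_def * tri_Suc by (simp add: power_add algebra_simps)
qed

text \<open>Write \<open>q ^ k * (1 - q ^ Suc n)\<close> as
  \<open>1 - (1 - q ^ k) - q ^ (k + Suc n)\<close>. By \<open>shanks_term_shift\<close> the two
  correction sums cancel except at \<open>k = n\<close>. That boundary term yields the first new
  power of \<open>q\<close>, and the new summand \<open>k = Suc n\<close> yields the second.\<close>

lemma shanks_sum_Suc:
  "(\<Sum>k\<le>Suc n. shanks_term q (Suc n) k) = (\<Sum>k\<le>n. shanks_term q n k)
    + (- 1) ^ Suc n * (q ^ (Suc n * Suc (Suc n) div 2 + Suc n * n)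
    + q ^ (Suc n * Suc (Suc n) div 2 + Suc n * Suc n))"
proof -
  let ?t = "shanks_term q"
  have "(\<Sum>k\<le>n. ?t (Suc n) k) = (\<Sum>k\<le>n. ?t n k - (1 - q ^ k) * ?t n k - q ^ (k + Suc n) * ?t n k)"
    by (intro sum.cong refl) (simp add: shanks_term_Suc power_add algebra_simps)
  also have "\<dots> = (\<Sum>k\<le>n. ?t n k) - (\<Sum>k\<le>n. (1 - q ^ k) * ?t n k) - (\<Sum>k\<le>n. q ^ (k + Suc n) * ?t n k)"
    by (simp add: sum_subtractf)
  also have "(\<Sum>k\<le>n. (1 - q ^ k) * ?t n k) = (\<Sum>k<n. (1 - q ^ Suc k) * ?t n (Suc k))"
    by (simp add: sum.atMost_shift)
  also have "\<dots> = - (\<Sum>k<n. q ^ (k + Suc n) * ?t n k)"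
    unfolding sum_negf [symmetric] by (intro sum.cong refl shanks_term_shift) simp
  also have "(\<Sum>k\<le>n. q ^ (k + Suc n) * ?t n k)
      = (\<Sum>k<n. q ^ (k + Suc n) * ?t n k) + q ^ (n + Suc n) * ?t n n"
    by (simp add: lessThan_Suc_atMost [symmetric])
  finally have "(\<Sum>k\<le>n. ?t (Suc n) k) = (\<Sum>k\<le>n. ?t n k) - q ^ (n + Suc n) * ?t n n"
    by simp
  moreover have "q ^ (n + Suc n) * ?t n n = (- 1) ^ n * q ^ (Suc n * Suc (Suc n) div 2 + Suc n * n)"
  proof -
    have "n * Suc n div 2 + n * n + (n + Suc n) = Suc n * Suc (Suc n) div 2 + Suc n * n"
      unfolding tri_Suc by simp
    from arg_cong [OF this, of "\<lambda>e. q ^ e"] show ?thesis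
      by (simp add: shanks_term_def power_add mult_ac del: mult_Suc mult_Suc_right)
  qed
  ultimately show ?thesis
    by (simp add: shanks_term_def algebra_simps del: mult_Suc mult_Suc_right)
qed

lemma shanks_identity:
  "(\<Sum>k\<le>n. shanks_term q n k) = 1 + (\<Sum>k<n. (- 1) ^ Suc k *
     (q ^ (Suc k * Suc (Suc k) div 2 + Suc k * k)
      + q ^ (Suc k * Suc (Suc k) div 2 + Suc k * Suc k)))"
proof (induction n)
  case 0
  show ?case
    by (simp add: shanks_term_def)
next
  case (Suc n)
  show ?case
    unfolding shanks_sum_Suc Suc.IH by simp
qed

section \<open>Truncated Euler products and the coefficients of \<open>E 1\<close>\<close>

definition qpoch :: "nat \<Rightarrow> nat \<Rightarrow> rat fps" where
  "qpoch j n = (\<Prod>i<n. 1 - fps_X ^ (j * Suc i))"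

lemma qpoch_Suc: "qpoch j (Suc n) = qpoch j n * (1 - fps_X ^ (j * Suc n))"
  by (simp add: qpoch_def)

lemma qpoch_0 [simp]: "qpoch j 0 = 1"
  by (simp add: qpoch_def)

lemma E_nth:
  assumes "j \<ge> 1" "m \<le> n"
  shows "E j $ m = qpoch j n $ m"
proof -
  have "E j $ m = qpoch j (Suc n) $ m"
    unfolding E_has_prod(2) [OF assms(1)] E_partial_nth [OF assms, symmetric] qpoch_def
      lessThan_Suc_atMost ..
  \<comment> \<open>The last factor of \<open>qpoch j (Suc n)\<close> only touches exponents above
    \<open>m\<close>, so one factor fewer than in the defining partial products is enough.\<close>
  moreover have "m < j * Suc n"
    using assms by (metis le_imp_less_Suc less_le_trans mult_le_mono1 mult_1)
  ultimately show ?thesis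
    by (simp add: qpoch_Suc right_diff_distrib fps_X_power_mult_right_nth del: mult_Suc_right)
qed

lemma E_nth_0 [simp]: "j \<ge> 1 \<Longrightarrow> E j $ 0 = 1"
  using E_nth [of j 0 0] by simp

definition pent_indices :: "nat \<Rightarrow> int set" where
  "pent_indices n = {k. k * (3 * k - 1) = 2 * int n}"

definition pent_coeff :: "nat \<Rightarrow> rat" where
  "pent_coeff n = (\<Sum>k\<in>pent_indices n. (- 1) ^ nat \<bar>k\<bar>)"

lemma pent_indices_bound:
  assumes "k \<in> pent_indices n"
  shows "\<bar>k\<bar> \<le> int n"
proof -
  have eq: "k * (3 * k - 1) = 2 * int n"
    using assms by (simp add: pent_indices_def)
  have sq: "\<bar>k\<bar> \<le> k * k"
    using mult_right_mono [of 1 "\<bar>k\<bar>" "\<bar>k\<bar>"] by (cases "k = 0") auto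
  have "k * (3 * k - 1) = 3 * (k * k) - k"
    by (simp add: algebra_simps)
  then show ?thesis
    using eq sq by linarith
qed

text \<open>Coefficient \<open>n\<close> is compared in Shanks' identity with exactly
  \<open>n\<close> factors: on the left only the product itself reaches exponent \<open>n\<close>,
  and the right side is a truncated pentagonal series.\<close>

lemma E_1_nth: "E 1 $ n = pent_coeff n"
proof -
  define f1 where "f1 k = Suc k * Suc (Suc k) div 2 + Suc k * k" for k
  define f2 where "f2 k = Suc k * Suc (Suc k) div 2 + Suc k * Suc k" for k
  have "E 1 $ n = (\<Sum>k\<le>n. shanks_term (fps_X :: rat fps) n k) $ n"
  proof -
    have "shanks_term (fps_X :: rat fps) n (Suc k) $ n = 0" for k
    proof -
      have "n < Suc k * Suc (Suc k) div 2 + Suc k * n"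
        unfolding tri_Suc by simp
      then show ?thesis
        by (simp add: shanks_term_def mult.assoc fps_X_power_mult_nth
          minus_one_power_iff del: mult_Suc mult_Suc_right)
    qed
    moreover have "shanks_term (fps_X :: rat fps) n 0 = qpoch 1 n"
      by (simp add: shanks_term_def qpoch_def lessThan_atLeast0)
    ultimately show ?thesis
      using E_nth [of 1 n n] by (simp add: sum.atMost_shift fps_sum_nth)
  qed
  also have "\<dots> = (if n = 0 then 1 else 0)
      + (\<Sum>k<n. (- 1) ^ Suc k * ((if n = f1 k then 1 else 0) + (if n = f2 k then 1 else 0)))"
  proof -
    have *: "((- 1) ^ Suc k * f) $ n = (- 1) ^ Suc k * (f $ n)" for f :: "rat fps" and k
      by (simp add: minus_one_power_iff)
    show ?thesis
      unfolding shanks_identity f1_def [symmetric] f2_def [symmetric] fps_add_nth fps_sum_nth *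
      by simp
  qed
  also have "\<dots> = (\<Sum>k\<in>{- int n..int n}. if k * (3 * k - 1) = 2 * int n then (- 1) ^ nat \<bar>k\<bar> else 0)"
    (is "_ = sum ?g _")
  proof -
    \<comment> \<open>The exponents \<open>f1\<close> belong to the positive indices
      \<open>k + 1\<close>, the exponents \<open>f2\<close> to the negative indices
      \<open>- (k + 1)\<close>.\<close>
    have f1: "n = f1 k \<longleftrightarrow> (int (Suc k)) * (3 * (int (Suc k)) - 1) = 2 * int n" for k
    proof -
      have "2 * f1 k = Suc k * (3 * k + 2)"
        unfolding f1_def add_mult_distrib2 by (subst dvd_mult_div_cancel) (auto simp: algebra_simps)
      then have "2 * int (f1 k) = int (Suc k * (3 * k + 2))"
        by (metis of_nat_mult of_nat_numeral)
      then have "2 * int (f1 k) = (int (Suc k)) * (3 * (int (Suc k)) - 1)"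
        by (simp add: algebra_simps)
      then show ?thesis by linarith
    qed
    have f2: "n = f2 k \<longleftrightarrow> (- int (Suc k)) * (3 * (- int (Suc k)) - 1) = 2 * int n" for k
    proof -
      have "2 * f2 k = Suc k * (3 * k + 4)"
        unfolding f2_def add_mult_distrib2 by (subst dvd_mult_div_cancel) (auto simp: algebra_simps)
      then have "2 * int (f2 k) = int (Suc k * (3 * k + 4))"
        by (metis of_nat_mult of_nat_numeral)
      then have "2 * int (f2 k) = (- int (Suc k)) * (3 * (- int (Suc k)) - 1)"
        by (simp add: algebra_simps)
      then show ?thesis by linarith
    qed
    have "{- int n..int n} = {0} \<union> (\<lambda>k. int (Suc k)) ` {..<n} \<union> (\<lambda>k. - int (Suc k)) ` {..<n}"
    proof (intro equalityI subsetI)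
      fix k
      assume "k \<in> {- int n..int n}"
      then have "k = 0 \<or> (k = int (Suc (nat (k - 1))) \<and> nat (k - 1) < n) \<or>
          (k = - int (Suc (nat (- k - 1))) \<and> nat (- k - 1) < n)"
        unfolding atLeastAtMost_iff by linarith
      then show "k \<in> {0} \<union> (\<lambda>k. int (Suc k)) ` {..<n} \<union> (\<lambda>k. - int (Suc k)) ` {..<n}"
        by blast
    qed auto
    then have "sum ?g {- int n..int n} =
        sum ?g ({0} \<union> (\<lambda>k. int (Suc k)) ` {..<n} \<union> (\<lambda>k. - int (Suc k)) ` {..<n})"
      by (rule arg_cong)
    also have "\<dots> = sum ?g ({0} \<union> (\<lambda>k. int (Suc k)) ` {..<n})
        + sum ?g ((\<lambda>k. - int (Suc k)) ` {..<n})"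
      by (rule sum.union_disjoint) auto
    also have "sum ?g ({0} \<union> (\<lambda>k. int (Suc k)) ` {..<n})
        = sum ?g {0} + sum ?g ((\<lambda>k. int (Suc k)) ` {..<n})"
      by (rule sum.union_disjoint) auto
    also have "sum ?g ((\<lambda>k. int (Suc k)) ` {..<n}) = (\<Sum>k<n. ?g (int (Suc k)))"
      by (subst sum.reindex) (auto simp: inj_on_def simp del: of_nat_Suc)
    also have "sum ?g ((\<lambda>k. - int (Suc k)) ` {..<n}) = (\<Sum>k<n. ?g (- int (Suc k)))"
      by (subst sum.reindex) (auto simp: inj_on_def simp del: of_nat_Suc)
    finally have S: "sum ?g {- int n..int n}
        = sum ?g {0} + (\<Sum>k<n. ?g (int (Suc k)) + ?g (- int (Suc k)))"
      by (simp add: sum.distrib)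
    show ?thesis
      unfolding S f1 f2
      by (intro arg_cong2 [of _ _ _ _ "(+)"] sum.cong refl)
        (auto simp: distrib_left simp del: of_nat_Suc)
  qed
  also have "\<dots> = pent_coeff n"
    unfolding pent_coeff_def sum.inter_filter [OF finite_atLeastAtMost_int, symmetric]
    using pent_indices_bound [of _ n]
    by (intro sum.cong) (force simp: pent_indices_def)+
  finally show ?thesis .
qed

text \<open>For \<open>r = 0, 1, 2, 3, 4\<close> the residues of \<open>3 * r * r - r\<close> modulo
  5 are 0, 2, 0, 4, 4. Halving modulo 5 gives 0, 1, 0, 2, 2, and 1 comes from \<open>r = 1\<close>
  alone.\<close>

lemma pent_indices_mod_5:
  assumes "k \<in> pent_indices n"
  shows "n mod 5 \<in> {0, 1, 2}" and "n mod 5 = 1 \<Longrightarrow> k mod 5 = 1"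
proof -
  have eq: "3 * (k * k) - k = 2 * int n"
    using assms by (simp add: pent_indices_def algebra_simps)
  define r where "r = k mod 5"
  define s where "s = k div 5"
  have k: "k = 5 * s + r" and r: "r \<in> {0, 1, 2, 3, 4}"
    by (auto simp: r_def s_def)
  have "3 * (r * r) - r + 5 * (15 * (s * s) + 6 * (s * r) - s) = 2 * int n"
    unfolding eq [symmetric] k by (simp add: algebra_simps)
  then have *: "(3 * (r * r) - r) mod 5 = 2 * int n mod 5"
    by (metis mod_mult_self2)
  have "int (n mod 5) \<in> {0, 1, 2} \<and> (int (n mod 5) = 1 \<longrightarrow> r = 1)"
    using r * unfolding zmod_int by auto presburger+
  then have "n mod 5 \<in> {0, 1, 2} \<and> (n mod 5 = 1 \<longrightarrow> r = 1)"
    unfolding insert_iff empty_iff by presburger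
  then show "n mod 5 \<in> {0, 1, 2}" "n mod 5 = 1 \<Longrightarrow> k mod 5 = 1"
    unfolding r_def by auto
qed

lemma E_1_nth_eq_0: "E 1 $ (5 * n + 3) = 0" "E 1 $ (5 * n + 4) = 0"
proof -
  have "pent_indices (5 * n + 3) = {}" "pent_indices (5 * n + 4) = {}"
    using pent_indices_mod_5(1) [of _ "5 * n + 3"] pent_indices_mod_5(1) [of _ "5 * n + 4"]
    by fastforce+
  then show "E 1 $ (5 * n + 3) = 0" "E 1 $ (5 * n + 4) = 0"
    unfolding E_1_nth pent_coeff_def by simp_all
qed

text \<open>With \<open>k = 1 - 5 * j\<close>, the pentagonal number of \<open>k\<close> is 1 plus
  25 times that of \<open>j\<close>.\<close>

lemma pent_indices_5_1:
  "pent_indices (5 * n + 1) = (if 5 dvd n then (\<lambda>j. 1 - 5 * j) ` pent_indices (n div 5) else {})"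
proof -
  have eq: "(1 - 5 * j) * (3 * (1 - 5 * j) - 1) = 2 * int (5 * n + 1) \<longleftrightarrow> 5 * (j * (3 * j - 1))
      = 2 * int n" for j :: int
    by (simp add: algebra_simps) linarith
  have "k \<in> pent_indices (5 * n + 1) \<longleftrightarrow> (\<exists>j. k = 1 - 5 * j \<and> 5 * (j * (3 * j - 1)) = 2 * int n)"
      for k
  proof
    assume k: "k \<in> pent_indices (5 * n + 1)"
    have "k mod 5 = 1"
      by (rule pent_indices_mod_5(2) [OF k]) simp
    then have "k = 1 - 5 * (- (k div 5))"
      by presburger
    then obtain j where "k = 1 - 5 * j" ..
    then show "\<exists>j. k = 1 - 5 * j \<and> 5 * (j * (3 * j - 1)) = 2 * int n"
      using k eq [of j] by (auto simp: pent_indices_def)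
  next
    assume "\<exists>j. k = 1 - 5 * j \<and> 5 * (j * (3 * j - 1)) = 2 * int n"
    then show "k \<in> pent_indices (5 * n + 1)"
      using eq unfolding pent_indices_def by blast
  qed
  moreover have "5 * (j * (3 * j - 1)) = 2 * int n \<longleftrightarrow> 5 dvd n \<and> j \<in> pent_indices (n div 5)" for j
    unfolding pent_indices_def mem_Collect_eq by presburger
  ultimately show ?thesis
    by auto
qed

text \<open>The sign changes because \<open>1 - 5 * j\<close> and \<open>j\<close> have opposite
  parity. Hence the part of \<open>E 1\<close> with exponents \<open>5 * n + 1\<close> is
  \<open>- X * E 25\<close>.\<close>

lemma E_1_nth_5_1: "E 1 $ (5 * n + 1) = (if 5 dvd n then - (E 1 $ (n div 5)) else 0)"
proof -
  have "(- 1 :: rat) ^ nat \<bar>1 - 5 * j\<bar> = - ((- 1) ^ nat \<bar>j\<bar>)" for j :: int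
    by (auto simp: minus_one_power_iff even_nat_iff)
  moreover have "inj_on (\<lambda>j :: int. 1 - 5 * j) S" for S
    by (auto simp: inj_on_def)
  ultimately show ?thesis
    unfolding E_1_nth pent_coeff_def pent_indices_5_1 by (simp add: sum.reindex sum_negf)
qed

section \<open>The cube of the Euler product\<close>

text \<open>Up to sign, \<open>jac_coeff q n j\<close> is the coefficient of \<open>z ^ (j + 1)\<close> and of \<open>z ^ (- j)\<close> in
  \<open>(\<Prod>i\<le>n. 1 - z q^i) (\<Prod>i=1..n. 1 - q^i / z)\<close>; the recursion in \<open>n\<close> comes from the factor
  \<open>(1 - z q^(n+1)) (1 - q^(n+1) / z)\<close>. The weighted sum \<open>\<Sum>j. (2 j + 1) * jac_coeff q n j\<close> is
  minus the derivative at \<open>z = 1\<close>.\<close>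

fun jac_coeff :: "'a::comm_ring_1 \<Rightarrow> nat \<Rightarrow> nat \<Rightarrow> 'a" where
  "jac_coeff q 0 j = (if j = 0 then 1 else 0)"
| "jac_coeff q (Suc n) j = (1 + q ^ (2 * Suc n)) * jac_coeff q n j
     - q ^ Suc n * ((if j = 0 then - jac_coeff q n 0 else jac_coeff q n (j - 1))
                    + jac_coeff q n (Suc j))"

lemma jac_coeff_eq_0: "j > n \<Longrightarrow> jac_coeff q n j = 0"
  by (induction n arbitrary: j) auto

text \<open>The weights satisfy \<open>(2 * j + 3) + (2 * j - 1) = 2 * (2 * j + 1)\<close>, so one
  step of the recursion multiplies the weighted sum by \<open>1 + Q ^ 2 - 2 * Q\<close>, the square
  of the new factor \<open>1 - Q\<close>.\<close>

lemma jac_coeff_sum: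
  assumes "N \<ge> n"
  shows "(\<Sum>j\<le>N. of_nat (2 * j + 1) * jac_coeff q n j) = (\<Prod>i<n. 1 - q ^ Suc i) ^ 2"
  using assms
proof (induction n arbitrary: N)
  case 0
  show ?case
    by (subst sum.atMost_shift) simp
next
  case (Suc n)
  define d where "d = jac_coeff q n"
  define Q where "Q = q ^ Suc n"
  define S where "S = (\<Sum>j\<le>N. of_nat (2 * j + 1) * d j)"
  from Suc.prems obtain N' where N': "N = Suc N'"
    by (cases N) auto
  have dN: "d N = 0" "d (Suc N) = 0"
    using Suc.prems by (simp_all add: d_def jac_coeff_eq_0)
  \<comment> \<open>Shifting the index leaves the boundary terms \<open>- d 0\<close> here and
    \<open>+ d 0\<close> in \<open>down\<close>; they cancel.\<close>
  have up: "(\<Sum>j\<le>N. of_nat (2 * j + 1) * (if j = 0 then - d 0 else d (j - 1)))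
      = - d 0 + (\<Sum>j\<le>N. of_nat (2 * j + 3) * d j)"
  proof -
    have "(\<Sum>j\<le>N. of_nat (2 * j + 1) * (if j = 0 then - d 0 else d (j - 1)))
      = - d 0 + (\<Sum>j<N. of_nat (2 * Suc j + 1) * d j)"
      by (subst sum.atMost_shift) simp
    then show ?thesis
      using dN by (simp add: lessThan_Suc_atMost [symmetric] eval_nat_numeral)
  qed
  have down: "(\<Sum>j\<le>N. of_nat (2 * j + 1) * d (Suc j)) = (\<Sum>j\<le>N. (of_nat (2 * j) - 1) * d j) + d 0"
  proof -
    have "(\<Sum>j\<le>N. (of_nat (2 * j) - 1) * d j) = - d 0 + (\<Sum>j<N. (of_nat (2 * Suc j) - 1) * d (Suc j))"
      by (subst sum.atMost_shift) simp
    then show ?thesis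
      using dN by (simp add: lessThan_Suc_atMost [symmetric])
  qed
  have "(\<Sum>j\<le>N. of_nat (2 * j + 1) * jac_coeff q (Suc n) j)
    = (\<Sum>j\<le>N. (1 + Q ^ 2) * (of_nat (2 * j + 1) * d j)
       - Q * (of_nat (2 * j + 1) * (if j = 0 then - d 0 else d (j - 1)))
       - Q * (of_nat (2 * j + 1) * d (Suc j)))"
    unfolding jac_coeff.simps Q_def [symmetric] d_def [symmetric] power_even_eq
    by (intro sum.cong refl) (simp add: algebra_simps del: of_nat_add of_nat_mult)
  also have "\<dots> = (1 + Q ^ 2) * S - Q * (- d 0 + (\<Sum>j\<le>N. of_nat (2 * j + 3) * d j))
       - Q * ((\<Sum>j\<le>N. (of_nat (2 * j) - 1) * d j) + d 0)"
    unfolding sum_subtractf sum_distrib_left [symmetric] up down S_def ..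
  also have "\<dots> = (1 + Q ^ 2) * S
      - Q * ((\<Sum>j\<le>N. of_nat (2 * j + 3) * d j) + (\<Sum>j\<le>N. (of_nat (2 * j) - 1) * d j))"
    by (simp add: algebra_simps)
  also have "(\<Sum>j\<le>N. of_nat (2 * j + 3) * d j) + (\<Sum>j\<le>N. (of_nat (2 * j) - 1) * d j) = 2 * S"
    unfolding S_def sum.distrib [symmetric] sum_distrib_left
    by (intro sum.cong refl) (simp add: algebra_simps)
  also have "(1 + Q ^ 2) * S - Q * (2 * S) = (1 - Q) ^ 2 * S"
    by (simp add: power2_eq_square algebra_simps)
  also have "S = (\<Prod>i<n. 1 - q ^ Suc i) ^ 2"
    unfolding S_def d_def using Suc by simp
  finally show ?case
    by (simp add: Q_def power_mult_distrib mult.commute)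
qed

lemma jac_coeff_closed:
  fixes q :: "'a::comm_ring_1"
  assumes inv: "\<And>m. (\<Prod>i<m. 1 - q ^ Suc i) * I m = 1"
  shows "jac_coeff q n j = (if j \<le> n then (- 1) ^ j * q ^ (j * Suc j div 2)
    * (\<Prod>i<2 * n + 1. 1 - q ^ Suc i) * I (n - j) * I (n + j + 1) else 0)"
proof (induction n arbitrary: j)
  case 0
  then show ?case
    using inv [of 0] inv [of 1] by auto
next
  case (Suc n)
  define P where "P m = (\<Prod>i<m. 1 - q ^ Suc i)" for m
  have P_Suc: "P (Suc m) = P m * (1 - q ^ Suc m)" for m
    by (simp add: P_def)
  have I_0: "I 0 = 1"
    using inv [of 0] by simp
  have I_Suc: "I m = I (Suc m) * (1 - q ^ Suc m)" for m
  proof -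
    have "I m = I m * (P (Suc m) * I (Suc m))"
      using inv [of "Suc m"] unfolding P_def by simp
    also have "\<dots> = (P m * I m) * (I (Suc m) * (1 - q ^ Suc m))"
      by (simp add: P_Suc mult_ac)
    finally show ?thesis
      using inv [of m] unfolding P_def by simp
  qed
  define g where "g j = (- 1) ^ j * q ^ (j * Suc j div 2)" for j :: nat
  have g_Suc: "g (Suc j) = - (q ^ Suc j * g j)" for j
    unfolding g_def tri_Suc by (simp add: power_add)
  define R where "R = P (2 * n + 1)"
  define h where "h j = (if j \<le> n then g j * R * I (n - j) * I (n + j + 1) else 0)" for j
  have IH: "jac_coeff q n j = h j" for j
    unfolding Suc.IH h_def g_def R_def P_def by simp
  show ?case
  proof (cases "j \<le> Suc n")
    case False
    then show ?thesis
      by (simp add: jac_coeff_eq_0)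
  next
    case True
    \<comment> \<open>All three neighbours in the recursion are multiples of
      \<open>G * R * x * y\<close>. The value \<open>- 1\<close> of \<open>G\<close> at
      \<open>j = 0\<close> is chosen such that \<open>g j = - s * G\<close> holds there too.\<close>
    define Q s G x y where "Q = q ^ Suc n" and "s = q ^ j"
      and "G = (if j = 0 then - 1 else g (j - 1))"
      and "x = I (Suc n - j)" and "y = I (Suc n + j + 1)"
    have R: "P (2 * Suc n + 1) = R * (1 - Q ^ 2) * (1 - Q ^ 2 * q)"
    proof -
      have "P (2 * Suc n + 1) = P (Suc (Suc (2 * n + 1)))"
        by simp
      also have "\<dots> = R * (1 - q ^ (2 * Suc n)) * (1 - q ^ (2 * Suc n) * q)"
        unfolding P_Suc R_def by (simp add: mult_ac)
      finally show ?thesis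
        unfolding power_even_eq Q_def .
    qed
    have g: "g j = - s * G"
    proof (cases j)
      case 0
      then show ?thesis
        by (simp add: G_def g_def s_def)
    next
      case (Suc i)
      then show ?thesis
        using g_Suc [of i] by (simp add: G_def s_def)
    qed
    have sQ: "q ^ (Suc n - j) * s = Q"
      using True by (simp add: s_def Q_def flip: power_add)
    have y1: "I (n + j + 1) = y * (1 - Q * s * q)" and y2: "I (n + j)
        = y * (1 - Q * s * q) * (1 - Q * s)"
      using I_Suc [of "n + j"] I_Suc [of "n + j + 1"]
      by (simp_all add: y_def Q_def s_def power_add mult_ac)
    have x1: "s * I (n - j) = x * (s - Q)" if "j \<le> n"
    proof -
      have eq: "I (n - j) = x * (1 - q ^ (Suc n - j))"
        using I_Suc [of "n - j"] that by (simp add: x_def Suc_diff_le)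
      have "s * I (n - j) = x * (s - q ^ (Suc n - j) * s)"
        unfolding eq by (simp add: algebra_simps)
      then show ?thesis
        unfolding sQ .
    qed
    have d0: "h j = - G * R * x * y * (s - Q) * (1 - Q * s * q)"
    proof (cases "j \<le> n")
      case True
      have "h j = - G * R * (s * I (n - j)) * y * (1 - Q * s * q)"
        using True unfolding h_def y1 g by simp
      then show ?thesis
        unfolding x1 [OF True] by (simp add: mult_ac)
    next
      \<comment> \<open>Here \<open>j = Suc n\<close>: \<open>h j\<close> is 0 by definition, and
        the factor \<open>s - Q\<close> vanishes.\<close>
      case False
      then have "s = Q"
        using \<open>j \<le> Suc n\<close> by (simp add: s_def Q_def le_Suc_eq)
      then show ?thesis
        using False by (simp add: h_def)
    qed
    have dm: "(if j = 0 then - h 0 else h (j - 1)) = G * R * x * y * (1 - Q * s * q) * (1 - Q * s)"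
    proof (cases j)
      case 0
      then show ?thesis
        using y2 I_Suc [of n] by (simp add: h_def G_def g_def x_def y1)
    next
      case (Suc i)
      then show ?thesis
        using True y2 by (simp add: h_def G_def x_def mult_ac)
    qed
    have dp: "h (Suc j) = G * R * x * y * (s - Q) * (s * q - Q)"
    proof (cases "Suc j \<le> n")
      case True
      have eq: "I (n - Suc j) = I (n - j) * (1 - q ^ (n - j))"
        using I_Suc [of "n - Suc j"] True by (simp add: Suc_diff_Suc)
      have "q ^ (Suc n - j) = q * q ^ (n - j)"
        using True by (simp add: Suc_diff_le)
      then have "s * q * I (n - Suc j) = I (n - j) * (s * q - q ^ (Suc n - j) * s)"
        unfolding eq by (simp add: algebra_simps)
      then have x2: "s * q * I (n - Suc j) = I (n - j) * (s * q - Q)"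
        unfolding sQ .
      have "h (Suc j) = G * R * y * (s * (s * q * I (n - Suc j)))"
        using True by (simp add: h_def g_Suc g y_def s_def mult_ac)
      also have "\<dots> = G * R * y * (s * I (n - j)) * (s * q - Q)"
        unfolding x2 by (simp add: mult_ac)
      also have "s * I (n - j) = x * (s - Q)"
        using True by (intro x1) simp
      finally show ?thesis
        by (simp add: mult_ac)
    next
      \<comment> \<open>Now \<open>j\<close> is \<open>n\<close> or \<open>Suc n\<close>, and one of
        the last two factors vanishes.\<close>
      case False
      then have "s = Q \<or> s * q = Q"
        using \<open>j \<le> Suc n\<close> by (auto
            simp: s_def Q_def le_Suc_eq not_le mult.commute less_Suc_eq)
      then show ?thesis
        using False by (auto simp: h_def)
    qed
    have "jac_coeff q (Suc n) j = G * R * x * y *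
      (- ((1 + Q ^ 2) * (s - Q) * (1 - Q * s * q)) - Q * ((1 - Q * s * q) * (1 - Q * s) + (s
          - Q) * (s * q - Q)))"
      unfolding jac_coeff.simps IH dm d0 dp Q_def [symmetric] power_even_eq
      by (simp add: algebra_simps)
    also have "\<dots> = G * R * x * y * (- s * (1 - Q ^ 2) * (1 - Q ^ 2 * q))"
      by (rule arg_cong [of _ _ "(*) (G * R * x * y)"]) (simp add: algebra_simps power2_eq_square)
    also have "\<dots> = g j * P (2 * Suc n + 1) * x * y"
      unfolding R g by (simp add: mult_ac)
    finally show ?thesis
      using True by (simp add: g_def P_def x_def y_def)
  qed
qed

section \<open>Congruence of power series modulo powers of \<open>X\<close>\<close>

definition fps_agree :: "nat \<Rightarrow> 'a fps \<Rightarrow> 'a fps \<Rightarrow> bool" where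
  "fps_agree N f g \<longleftrightarrow> (\<forall>n\<le>N. f $ n = g $ n)"

lemma fps_agree_refl [simp]: "fps_agree N f f"
  by (simp add: fps_agree_def)

lemma fps_agree_sym: "fps_agree N f g \<Longrightarrow> fps_agree N g f"
  by (simp add: fps_agree_def)

lemma fps_agree_trans [trans]: "fps_agree N f g \<Longrightarrow> fps_agree N g h \<Longrightarrow> fps_agree N f h"
  by (simp add: fps_agree_def)

lemma fps_agree_mult:
  fixes f g :: "'a::semiring_0 fps"
  shows "fps_agree N f f' \<Longrightarrow> fps_agree N g g' \<Longrightarrow> fps_agree N (f * g) (f' * g')"
  by (auto simp: fps_agree_def fps_mult_nth intro!: sum.cong)

lemma fps_agree_power:
  fixes f g :: "'a::semiring_1 fps"
  shows "fps_agree N f g \<Longrightarrow> fps_agree N (f ^ k) (g ^ k)"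
  by (induction k) (simp_all add: fps_agree_mult)

lemma fps_agree_inverse:
  fixes f g :: "'a::field fps"
  assumes "fps_agree N f g" "f $ 0 \<noteq> 0"
  shows "fps_agree N (inverse f) (inverse g)"
proof -
  have "g $ 0 \<noteq> 0"
    using assms by (simp add: fps_agree_def)
  then have "inverse f = inverse f * (g * inverse g)"
    by (simp add: inverse_mult_eq_1')
  also have "fps_agree N \<dots> (inverse f * (f * inverse g))"
    using fps_agree_sym [OF assms(1)] by (intro fps_agree_mult) simp_all
  also have "inverse f * (f * inverse g) = inverse g"
    using assms(2) by (simp add: inverse_mult_eq_1 mult.assoc [symmetric])
  finally show ?thesis .
qed

lemma fps_agree_qpoch_E: "j \<ge> 1 \<Longrightarrow> N \<le> n \<Longrightarrow> fps_agree N (qpoch j n) (E j)"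
  unfolding fps_agree_def by (metis E_nth le_trans)

lemma qpoch_nth_0 [simp]: "j \<ge> 1 \<Longrightarrow> qpoch j n $ 0 = 1"
  by (induction n) (simp_all add: qpoch_Suc)

text \<open>The support is all that is needed of Jacobi's formula for \<open>E 1 ^ 3\<close>.\<close>

lemma E_1_cube_nth_eq_0:
  assumes "\<And>j. n \<noteq> j * Suc j div 2"
  shows "(E 1 ^ 3) $ n = 0"
proof -
  \<comment> \<open>Large enough that \<open>N - j \<ge> n\<close> for every \<open>j < n\<close>,
    so all products occurring in \<open>W\<close> agree with \<open>E 1\<close> up to exponent
    \<open>n\<close>.\<close>
  define N where "N = 2 * n"
  define q :: "rat fps" where "q = fps_X"
  have P: "(\<Prod>i<m. 1 - q ^ Suc i) = qpoch 1 m" for m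
    by (simp add: qpoch_def q_def)
  have closed: "jac_coeff q N j = (if j \<le> N then (- 1) ^ j * q ^ (j * Suc j div 2)
    * qpoch 1 (2 * N + 1) * inverse (qpoch 1 (N - j)) * inverse (qpoch 1 (N + j + 1)) else 0)" for j
    unfolding P [symmetric]
    by (rule jac_coeff_closed) (simp only: P, simp add: inverse_mult_eq_1')
  define e :: "nat \<Rightarrow> nat" where "e j = j * Suc j div 2" for j
  \<comment> \<open>Up to sign this product is \<open>q ^ e j * W\<close> with \<open>W\<close>
    congruent to 1 up to exponent \<open>n\<close> when \<open>e j < n\<close>, so among exponents
    up to \<open>n\<close> it can only contribute at \<open>e j\<close>.\<close>
  have vanish: "(qpoch 1 N * jac_coeff q N j) $ n = 0" for j
  proof (cases "j \<le> N")
    case True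
    define W where "W = qpoch 1 N * qpoch 1 (2 * N + 1)
      * inverse (qpoch 1 (N - j)) * inverse (qpoch 1 (N + j + 1))"
    have "qpoch 1 N * jac_coeff q N j = (- 1) ^ j * (q ^ e j * W)"
      using True by (simp add: closed [folded e_def] W_def mult_ac)
    moreover have "W $ (n - e j) = 0" if "e j < n"
    proof -
      have "j \<le> e j"
        by (cases j) (simp, simp only: e_def tri_Suc)
      then have "fps_agree n W (E 1 * E 1 * inverse (E 1) * inverse (E 1))"
        using that unfolding W_def
        by (intro fps_agree_mult fps_agree_inverse fps_agree_qpoch_E) (simp_all add: N_def)
      also have "E 1 * E 1 * inverse (E 1) * inverse (E 1) = 1"
        using inverse_mult_eq_1 [of "E 1"] by (simp add: algebra_simps)
      finally show ?thesis
        using that by (simp add: fps_agree_def)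
    qed
    moreover have "n \<noteq> e j"
      using assms by (simp add: e_def)
    ultimately show ?thesis
      by (auto simp: minus_one_power_iff q_def fps_X_power_mult_nth)
  qed (simp add: jac_coeff_eq_0)
  have "fps_agree n (E 1 ^ 3) (qpoch 1 N ^ 3)"
    by (intro fps_agree_power fps_agree_sym [OF fps_agree_qpoch_E]) (simp_all add: N_def)
  then have "(E 1 ^ 3) $ n = (qpoch 1 N * qpoch 1 N ^ 2) $ n"
    by (simp add: fps_agree_def power3_eq_cube power2_eq_square mult.assoc)
  also have "qpoch 1 N ^ 2 = (\<Sum>j\<le>N. of_nat (2 * j + 1) * jac_coeff q N j)"
    using jac_coeff_sum [of N N q] unfolding P by simp
  also have "(qpoch 1 N * \<dots>) $ n = (\<Sum>j\<le>N. of_nat (2 * j + 1) * ((qpoch 1 N * jac_coeff q N j) $ n))"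
  proof -
    have "(f * (of_nat m * g)) $ n = of_nat m * ((f * g) $ n)" for m and f g :: "rat fps"
      by (simp add: mult.left_commute [of f] flip: fps_of_nat)
    then show ?thesis
      by (simp only: sum_distrib_left fps_sum_nth)
  qed
  finally show ?thesis
    using vanish by simp
qed

section \<open>Dissection modulo 5\<close>

definition dil :: "'a::idom fps \<Rightarrow> 'a fps" where
  "dil f = f oo fps_X ^ 5"

lemma dil_nth: "dil f $ n = (if 5 dvd n then f $ (n div 5) else 0)"
  by (simp add: dil_def fps_nth_compose_X_power)

lemma dil_hom:
  "dil 0 = 0" "dil 1 = 1" "dil (numeral k) = numeral k" "dil (f + g) = dil f + dil g"
  "dil (f - g) = dil f - dil g" "dil (- f) = - dil f" "dil (f * g) = dil f * dil g"
  "dil (f ^ n) = dil f ^ n" "dil fps_X = fps_X ^ 5"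
  by (simp_all add: dil_def fps_compose_add_distrib fps_compose_sub_distrib fps_compose_uminus
      fps_compose_mult_distrib fps_compose_power)

lemma dil_inverse:
  fixes f :: "'a::field fps"
  shows "f $ 0 \<noteq> 0 \<Longrightarrow> dil (inverse f) = inverse (dil f)"
  by (simp add: dil_def fps_inverse_compose)

lemma dil_E:
  assumes "j \<ge> 1"
  shows "dil (E j) = E (5 * j)"
proof (rule fps_ext)
  fix n
  have "dil (qpoch j n) = qpoch (5 * j) n"
    by (induction n) (simp_all add: qpoch_Suc dil_hom mult.assoc flip: power_mult)
  then show "dil (E j) $ n = E (5 * j) $ n"
    using assms E_nth [of j "n div 5" n] E_nth [of "5 * j" n n]
    by (simp add: dil_nth) (metis dil_nth)
qed

definition sec :: "nat \<Rightarrow> 'a fps \<Rightarrow> 'a fps" where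
  "sec r f = Abs_fps (\<lambda>n. f $ (5 * n + r))"

lemma sec_nth [simp]: "sec r f $ n = f $ (5 * n + r)"
  by (simp add: sec_def)

lemma sec_linear:
  fixes f g :: "'a::comm_ring_1 fps"
  shows "sec r 0 = (0 :: 'a fps)" "sec r (f + g) = sec r f + sec r g"
    "sec r (f - g) = sec r f - sec r g" "sec r (- f) = - sec r f"
    "sec r (numeral k * f) = numeral k * sec r f" "sec r (of_int m * f) = of_int m * sec r f"
    "sec r (sum h A) = (\<Sum>a\<in>A. sec r (h a))"
  by (simp_all add: fps_eq_iff fps_sum_nth fps_numeral_fps_const fps_of_int [symmetric])

lemma sec_X_power_dil:
  assumes "r < 5" "s < 5"
  shows "sec r (fps_X ^ s * dil f) = (if r = s then f else 0)"
proof (rule fps_ext)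
  fix n
  have "r \<noteq> s \<Longrightarrow> 5 * n + r \<ge> s \<Longrightarrow> \<not> 5 dvd (5 * n + r - s)"
    using assms by presburger
  then show "sec r (fps_X ^ s * dil f) $ n = (if r = s then f else 0) $ n"
    using assms by (auto simp: fps_X_power_mult_nth dil_nth)
qed

lemma sec_decomp: "f = (\<Sum>s<5. fps_X ^ s * dil (sec s f))"
proof (rule fps_ext)
  fix n :: nat
  have "(fps_X ^ s * dil (sec s f)) $ n = (if s = n mod 5 then f $ n else 0)" if "s < 5" for s
  proof -
    have "s \<le> n \<and> 5 dvd (n - s) \<longleftrightarrow> s = n mod 5"
      using that by presburger
    moreover have "5 * ((n - n mod 5) div 5) + n mod 5 = n"
      by presburger
    ultimately show ?thesis
      by (auto simp: fps_X_power_mult_nth dil_nth)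
  qed
  then show "f $ n = (\<Sum>s<5. fps_X ^ s * dil (sec s f)) $ n"
    by (simp add: fps_sum_nth)
qed

text \<open>Series in \<open>X ^ 5\<close> act as scalars for \<open>sec r\<close>: multiplication
  by them preserves every summand of the dissection.\<close>

lemma sec_dil_mult:
  assumes "r < 5"
  shows "sec r (dil g * f) = g * sec r f"
proof -
  have "dil g * f = (\<Sum>s<5. fps_X ^ s * dil (g * sec s f))"
    by (subst sec_decomp [of f]) (simp add: sum_distrib_left dil_hom mult_ac)
  then have "sec r (dil g * f) = (\<Sum>s<5. sec r (fps_X ^ s * dil (g * sec s f)))"
    by (simp add: sec_linear)
  also have "\<dots> = (\<Sum>s<5. if r = s then g * sec s f else 0)"
    using assms by (intro sum.cong) (simp_all add: sec_X_power_dil)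
  also have "\<dots> = g * sec r f"
    using assms by simp
  finally show ?thesis .
qed

text \<open>The relation between \<open>a\<close> and \<open>c\<close> expresses that \<open>E 1 ^ 3\<close> has no exponents \<open>5 n + 2\<close>, as
  these are never triangular.\<close>

lemma E_1_dissection:
  obtains a c where "E 1 = dil a - fps_X * dil (E 5) + fps_X ^ 2 * dil c" "a $ 0 = 1"
    "a * c = - (E 5 ^ 2)"
proof
  define a c where "a = sec 0 (E 1)" and "c = sec 2 (E 1)"
  have s34: "sec 3 (E 1) = 0" "sec 4 (E 1) = 0"
    by (simp_all add: fps_eq_iff E_1_nth_eq_0 [simplified])
  have "sec 1 (E 1) = - dil (E 1)"
    using E_1_nth_5_1 by (simp add: fps_eq_iff dil_nth)
  then have s1: "sec 1 (E 1) = - E 5"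
    using dil_E [of 1] by simp
  show E: "E 1 = dil a - fps_X * dil (E 5) + fps_X ^ 2 * dil c"
  proof -
    have "{..<5 :: nat} = {0, 1, 2, 3, 4}"
      by auto
    then show ?thesis
      by (subst sec_decomp) (simp add: s34 s1 a_def c_def dil_hom del: One_nat_def)
  qed
  show a0: "a $ 0 = 1"
    by (simp add: a_def)
  define b where "b = E 5"
  \<comment> \<open>Expand the cube and group by residues of exponents modulo 5; the part for
    residue 2 contains the factor \<open>a * c + b ^ 2\<close>.\<close>
  have "E 1 ^ 3 = fps_X ^ 0 * dil (a ^ 3 - 3 * fps_X * b * c ^ 2)
      + fps_X ^ 1 * dil (- 3 * a ^ 2 * b + fps_X * c ^ 3)
          + fps_X ^ 2 * dil (3 * a * (a * c + b ^ 2))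
              + fps_X ^ 3 * dil (- (b ^ 3) - 6 * a * b * c)
                  + fps_X ^ 4 * dil (3 * b ^ 2 * c + 3 * a * c ^ 2)"
    unfolding E b_def [symmetric] dil_hom by algebra
  then have "sec 2 (E 1 ^ 3) = 3 * a * (a * c + b ^ 2)"
    by (simp only: sec_linear sec_X_power_dil) simp
  moreover have "sec 2 (E 1 ^ 3) = 0"
  proof (rule fps_ext)
    fix n
    \<comment> \<open>Twice the left side is 4 modulo 5, whereas \<open>j * Suc j\<close> only takes
      the residues 0, 1, 2.\<close>
    have "5 * n + 2 \<noteq> j * Suc j div 2" for j
    proof
      assume "5 * n + 2 = j * Suc j div 2"
      then have "j * Suc j = 2 * (5 * n + 2)"
        by (metis dvd_mult_div_cancel even_Suc even_mult_iff)
      then have "(j mod 5) * (Suc j mod 5) mod 5 = 2 * (5 * n + 2) mod 5"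
        by (metis mod_mult_eq)
      then have *: "(j mod 5) * (Suc j mod 5) mod 5 = 4"
        by presburger
      have "j mod 5 \<in> {0,1,2,3,4}"
        by auto
      then show False
        using * by (auto simp: mod_Suc)
    qed
    then show "sec 2 (E 1 ^ 3) $ n = 0 $ n"
      using E_1_cube_nth_eq_0 [of "5 * n + 2"] by (simp del: One_nat_def add_2_eq_Suc')
  qed
  moreover have "3 * a \<noteq> 0"
    using a0 by auto
  ultimately have "a * c + b ^ 2 = 0"
    by (metis mult_eq_0_iff)
  then show "a * c = - (E 5 ^ 2)"
    by (simp add: b_def eq_neg_iff_add_eq_0)
qed

section \<open>The modular equation of degree 5\<close>

text \<open>This is the substitution of \<open>w * X\<close> for \<open>X\<close>. For
  \<open>w = 1\<close> it is the embedding into complex series, through which identities return to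
  the rationals by \<open>twist_1_inj\<close>.\<close>

definition twist :: "complex \<Rightarrow> rat fps \<Rightarrow> complex fps" where
  "twist w f = Abs_fps (\<lambda>n. w ^ n * of_rat (f $ n))"

lemma twist_nth [simp]: "twist w f $ n = w ^ n * of_rat (f $ n)"
  by (simp add: twist_def)

lemma twist_mult: "twist w (f * g) = twist w f * twist w g"
proof (rule fps_ext)
  fix n
  have "w ^ n = w ^ i * w ^ (n - i)" if "i \<le> n" for i
    using that by (simp flip: power_add)
  then show "twist w (f * g) $ n = (twist w f * twist w g) $ n"
    by (auto simp: fps_mult_nth of_rat_sum of_rat_mult sum_distrib_left mult_ac intro!: sum.cong)
qed

lemma twist_linear:
  "twist w 1 = 1" "twist w (f + g) = twist w f + twist w g" "twist w (f - g)
      = twist w f - twist w g"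
  by (simp_all add: fps_eq_iff of_rat_add of_rat_diff distrib_left right_diff_distrib)

lemma twist_numeral: "twist w (numeral k) = numeral k"
  by (simp add: fps_eq_iff fps_numeral_nth)

lemma twist_power: "twist w (f ^ n) = twist w f ^ n"
  by (induction n) (simp_all add: twist_linear twist_mult)

lemma twist_X: "twist w fps_X = fps_const w * fps_X"
  by (auto simp: fps_eq_iff le_Suc_eq)

lemma twist_dil: "w ^ 5 = 1 \<Longrightarrow> twist w (dil f) = twist 1 (dil f)"
  by (auto simp: fps_eq_iff dil_nth power_mult elim!: dvdE)

lemma twist_1_inj: "twist 1 f = twist 1 g \<Longrightarrow> f = g"
  by (simp add: fps_eq_iff)

lemma fps_agree_twist: "fps_agree N f g \<Longrightarrow> fps_agree N (twist w f) (twist w g)"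
  by (simp add: fps_agree_def)

section \<open>Fifth roots of unity\<close>

lemma fifth_root_of_unity_exists: "\<exists>w :: complex. 1 + w + w ^ 2 + w ^ 3 + w ^ 4 = 0"
proof -
  define w where "w = cis (2 * pi / 5)"
  have "w ^ 5 = 1"
    using Complex.DeMoivre [of "2 * pi / 5" 5] by (simp add: w_def)
  moreover have "w \<noteq> 1"
  proof
    assume "w = 1"
    moreover have "sin (2 * pi / 5) > 0"
      by (rule sin_gt_zero) simp_all
    ultimately show False
      by (auto simp: w_def complex_eq_iff)
  qed
  moreover have "(w - 1) * (1 + w + w ^ 2 + w ^ 3 + w ^ 4) = w ^ 5 - 1"
    by (simp add: algebra_simps eval_nat_numeral)
  ultimately show ?thesis
    by (metis diff_self mult_eq_0_iff right_minus_eq)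
qed

text \<open>The hypothesis is the fifth cyclotomic equation, stated over a domain so that it also
  applies to a root of unity taken as a constant power series.\<close>

lemma fifth_root_of_unity_reduce:
  fixes w :: "'a::idom"
  assumes "1 + w + w ^ 2 + w ^ 3 + w ^ 4 = 0"
  shows "w ^ 5 = 1" "w ^ 6 = w" "w ^ 7 = w ^ 2" "w ^ 8 = w ^ 3" "w ^ 9 = w ^ 4" "w ^ 10 = 1"
    "w ^ 12 = w ^ 2" "w ^ 16 = w"
proof -
  have "w ^ 5 - 1 = (w - 1) * (1 + w + w ^ 2 + w ^ 3 + w ^ 4)"
    by (simp add: algebra_simps eval_nat_numeral)
  then show *: "w ^ 5 = 1"
    using assms by simp
  have "w ^ 6 = w ^ 5 * w" "w ^ 7 = w ^ 5 * w ^ 2" "w ^ 8 = w ^ 5 * w ^ 3" "w ^ 9 = w ^ 5 * w ^ 4"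
    "w ^ 10 = w ^ 5 * w ^ 5" "w ^ 12 = w ^ 5 * w ^ 5 * w ^ 2" "w ^ 16 = w ^ 5 * w ^ 5 * w ^ 5 * w"
    by algebra+
  then show "w ^ 6 = w" "w ^ 7 = w ^ 2" "w ^ 8 = w ^ 3" "w ^ 9 = w ^ 4" "w ^ 10 = 1"
    "w ^ 12 = w ^ 2" "w ^ 16 = w"
    unfolding * by simp_all
qed

lemma fifth_root_of_unity_power:
  fixes w :: "'a::idom"
  assumes w: "1 + w + w ^ 2 + w ^ 3 + w ^ 4 = 0" and m: "\<not> 5 dvd m"
  shows "1 + w ^ m + (w ^ m) ^ 2 + (w ^ m) ^ 3 + (w ^ m) ^ 4 = 0"
proof -
  have "w ^ m = w ^ (5 * (m div 5) + m mod 5)"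
    by simp
  also have "\<dots> = w ^ (m mod 5)"
    unfolding power_add power_mult fifth_root_of_unity_reduce(1) [OF w] by simp
  finally have eq: "w ^ m = w ^ (m mod 5)" .
  have "m mod 5 \<noteq> 0" "m mod 5 < 5"
    using m by (auto simp: dvd_eq_mod_eq_0)
  then have "m mod 5 = 1 \<or> m mod 5 = 2 \<or> m mod 5 = 3 \<or> m mod 5 = 4"
    by linarith
  then show ?thesis
    unfolding eq using w
    by (elim disjE)
      (simp_all add: fifth_root_of_unity_reduce [OF w] power_mult [symmetric] add_ac)
qed

text \<open>Conjugate factors are paired; the sums \<open>s\<close> and \<open>t\<close> of
  conjugate roots satisfy \<open>s + t = s * t = - 1\<close>.\<close>

lemma fifth_root_of_unity_prod:
  fixes w :: "'a::idom"
  assumes w: "1 + w + w ^ 2 + w ^ 3 + w ^ 4 = 0"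
  shows "(1 - x) * (1 - w * x) * (1 - w ^ 2 * x) * (1 - w ^ 3 * x) * (1 - w ^ 4 * x) = 1 - x ^ 5"
proof -
  define s t where "s = w + w ^ 4" and "t = w ^ 2 + w ^ 3"
  have "(1 - w * x) * (1 - w ^ 4 * x) = 1 - s * x + w ^ 5 * x ^ 2"
    unfolding s_def by algebra
  moreover have "(1 - w ^ 2 * x) * (1 - w ^ 3 * x) = 1 - t * x + w ^ 5 * x ^ 2"
    unfolding t_def by algebra
  moreover have "s * t = w ^ 3 + w ^ 4 + w ^ 6 + w ^ 7"
    unfolding s_def t_def by algebra
  ultimately have 1: "(1 - w * x) * (1 - w ^ 4 * x) = 1 - s * x + x ^ 2"
    and 2: "(1 - w ^ 2 * x) * (1 - w ^ 3 * x) = 1 - t * x + x ^ 2" and 3: "s * t = s + t"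
    by (simp_all add: fifth_root_of_unity_reduce [OF w] s_def t_def)
  have "s + t = (1 + w + w ^ 2 + w ^ 3 + w ^ 4) - 1"
    by (simp add: s_def t_def)
  then have t: "s + t = - 1"
    using w by simp
  have "(1 - x) * (1 - w * x) * (1 - w ^ 2 * x) * (1 - w ^ 3 * x) * (1 - w ^ 4 * x)
    = (1 - x) * ((1 - w * x) * (1 - w ^ 4 * x)) * ((1 - w ^ 2 * x) * (1 - w ^ 3 * x))"
    by (simp only: mult_ac)
  also have "\<dots> = (1 - x) * (1 + x ^ 4 + 2 * x ^ 2 - (s + t) * (x + x ^ 3) + s * t * x ^ 2)"
    unfolding 1 2 by algebra
  also have "\<dots> = 1 - x ^ 5"
    unfolding 3 t by algebra
  finally show ?thesis .
qed

text \<open>The left side will be the product of the conjugates of \<open>E 1\<close>. After pairing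
  conjugates, \<open>a * c = - (b ^ 2)\<close> makes \<open>a\<close> and \<open>c\<close> enter
  only through \<open>p = a + c = e + b\<close>, and \<open>s ^ 2 = 1 - s\<close> eliminates the
  root of unity.\<close>

lemma fifth_root_of_unity_trinomial:
  fixes w a b c :: "'a::idom"
  assumes w: "1 + w + w ^ 2 + w ^ 3 + w ^ 4 = 0" and ac: "a * c = - (b ^ 2)" and e: "e = a - b + c"
  shows "e * (a - w * b + w ^ 2 * c) * (a - w ^ 2 * b + w ^ 4 * c) * (a - w ^ 3 * b + w ^ 6 * c) *
      (a - w ^ 4 * b + w ^ 8 * c)
    = e ^ 5 + 5 * e ^ 4 * b + 15 * e ^ 3 * b ^ 2 + 25 * e ^ 2 * b ^ 3 + 25 * e * b ^ 4"
proof -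
  define p s t where "p = a + c" and "s = w + w ^ 4" and "t = w ^ 2 + w ^ 3"
  note red = fifth_root_of_unity_reduce [OF w]
  have "t = (1 + w + w ^ 2 + w ^ 3 + w ^ 4) - 1 - s"
    by (simp add: s_def t_def)
  then have t: "t = - 1 - s"
    using w by simp
  have "s ^ 2 = w ^ 2 + w ^ 8 + 2 * w ^ 5"
    unfolding s_def by algebra
  then have s: "s ^ 2 = 1 - s"
    using t unfolding red t_def by (simp add: algebra_simps)
  have p: "a ^ 2 + c ^ 2 = p ^ 2 + 2 * b ^ 2"
    using ac unfolding p_def by algebra
  have "(a - w * b + w ^ 2 * c) * (a - w ^ 4 * b + w ^ 8 * c)
    = a ^ 2 + w ^ 5 * b ^ 2 + w ^ 10 * c ^ 2 - (w + w ^ 4) * (a * b) + (w ^ 2 + w ^ 8) * (a * c)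
      - (w ^ 9 + w ^ 6) * (b * c)"
    by algebra
  also have "\<dots> = (a ^ 2 + c ^ 2) + b ^ 2 - s * b * p + t * (a * c)"
    unfolding red p_def s_def t_def by (simp add: algebra_simps)
  finally have f1: "(a - w * b + w ^ 2 * c) * (a - w ^ 4 * b + w ^ 8 * c)
      = p ^ 2 + (3 - t) * b ^ 2 - s * b * p"
    unfolding p ac by (simp add: algebra_simps)
  have "(a - w ^ 2 * b + w ^ 4 * c) * (a - w ^ 3 * b + w ^ 6 * c)
    = a ^ 2 + w ^ 5 * b ^ 2 + w ^ 10 * c ^ 2 - (w ^ 2 + w ^ 3) * (a * b) + (w ^ 6 + w ^ 4) * (a * c)
      - (w ^ 8 + w ^ 7) * (b * c)"
    by algebra
  also have "\<dots> = (a ^ 2 + c ^ 2) + b ^ 2 - t * b * p + s * (a * c)"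
    unfolding red p_def s_def t_def by (simp add: algebra_simps)
  finally have f2: "(a - w ^ 2 * b + w ^ 4 * c) * (a - w ^ 3 * b + w ^ 6 * c)
      = p ^ 2 + (3 - s) * b ^ 2 - t * b * p"
    unfolding p ac by (simp add: algebra_simps)
  have pe: "p = e + b"
    by (simp add: p_def e)
  have "e * (p ^ 2 + (3 - t) * b ^ 2 - s * b * p) * (p ^ 2 + (3 - s) * b ^ 2 - t * b * p)
    = e * (p ^ 4 + p ^ 3 * b + (7 - s - s ^ 2) * p ^ 2 * b ^ 2 + (4 + 2 * s + 2 * s ^ 2) * p * b ^ 3
       + (12 - s - s ^ 2) * b ^ 4)"
    unfolding t by algebra
  also have "\<dots> = e ^ 5 + 5 * e ^ 4 * b + 15 * e ^ 3 * b ^ 2 + 25 * e ^ 2 * b ^ 3 + 25 * e * b ^ 4"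
    unfolding s pe by algebra
  finally show ?thesis
    unfolding f1 [symmetric] f2 [symmetric] by (simp only: mult_ac)
qed

definition twist_norm :: "complex \<Rightarrow> rat fps \<Rightarrow> complex fps" where
  "twist_norm w f = twist 1 f * twist w f * twist (w ^ 2) f * twist (w ^ 3) f * twist (w ^ 4) f"

lemma twist_norm_mult: "twist_norm w (f * g) = twist_norm w f * twist_norm w g"
  by (simp add: twist_norm_def twist_mult mult_ac)

text \<open>If 5 divides \<open>m\<close>, all five conjugates coincide; otherwise
  \<open>w ^ m\<close> is again a primitive fifth root of unity.\<close>

lemma twist_norm_factor:
  assumes w: "1 + w + w ^ 2 + w ^ 3 + w ^ 4 = 0"
  shows "twist_norm w (1 - fps_X ^ m)
      = (if 5 dvd m then (1 - fps_X ^ m) ^ 5 else 1 - fps_X ^ (5 * m))"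
proof -
  define u where "u = fps_const w ^ m"
  have tw: "twist (w ^ k) (1 - fps_X ^ m) = 1 - u ^ k * fps_X ^ m" for k
    by (simp add: twist_linear twist_power twist_X power_mult_distrib u_def power_mult [symmetric]
        fps_const_power mult.commute)
  have eq: "twist_norm w (1 - fps_X ^ m) = (1 - fps_X ^ m) * (1 - u * fps_X ^ m)
     * (1 - u ^ 2 * fps_X ^ m) * (1 - u ^ 3 * fps_X ^ m) * (1 - u ^ 4 * fps_X ^ m)"
    unfolding twist_norm_def tw using tw [of 0] tw [of 1] by simp
  have W: "1 + fps_const w + fps_const w ^ 2 + fps_const w ^ 3 + fps_const w ^ 4 = 0"
  proof -
    have "fps_const (1 + w + w ^ 2 + w ^ 3 + w ^ 4) = 0"
      using w by simp
    then show ?thesis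
      by (simp add: fps_const_power flip: fps_const_add fps_const_1_eq_1)
  qed
  show ?thesis
  proof (cases "5 dvd m")
    case True
    then have "u = 1"
      using fifth_root_of_unity_reduce(1) [OF W] by (auto simp: u_def power_mult elim!: dvdE)
    then show ?thesis
      using True unfolding eq by (simp add: eval_nat_numeral)
  next
    case False
    show ?thesis
      using False fifth_root_of_unity_prod [OF fifth_root_of_unity_power [OF W False], of "fps_X ^ m"]
      unfolding eq u_def by (simp add: power_mult [symmetric] mult.commute)
  qed
qed

text \<open>The indices prime to 5 contribute \<open>qpoch 5 (5 * n)\<close> without its factors at
  multiples of 5, which form \<open>qpoch 25 n\<close>; the multiples of 5 contribute
  \<open>qpoch 5 n ^ 5\<close>. The induction adds five factors at a time.\<close>

lemma twist_norm_qpoch: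
  assumes w: "1 + w + w ^ 2 + w ^ 3 + w ^ 4 = 0"
  shows "twist_norm w (qpoch 1 (5 * n)) * twist 1 (qpoch 25 n)
    = twist 1 (qpoch 5 (5 * n)) * twist 1 (qpoch 5 n) ^ 5"
proof (induction n)
  case 0
  then show ?case
    by (simp add: twist_norm_def twist_linear)
next
  case (Suc n)
  let ?f = "\<lambda>m. 1 - fps_X ^ m"
  have tw: "twist 1 (?f m) = ?f m" for m
    by (simp add: twist_linear twist_power twist_X)
  have q: "qpoch j (5 * Suc n)
      = qpoch j (5 * n) * (?f (j * (5 * n + 1)) * ?f (j * (5 * n + 2)) * ?f (j * (5 * n + 3)) * ?f
          (j * (5 * n + 4)) * ?f (j * (5 * n + 5)))" for j
  proof -
    have "qpoch j (5 * n + 1) = qpoch j (5 * n) * ?f (j * (5 * n + 1))"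
      "qpoch j (5 * n + 2) = qpoch j (5 * n + 1) * ?f (j * (5 * n + 2))"
      "qpoch j (5 * n + 3) = qpoch j (5 * n + 2) * ?f (j * (5 * n + 3))"
      "qpoch j (5 * n + 4) = qpoch j (5 * n + 3) * ?f (j * (5 * n + 4))"
      "qpoch j (5 * n + 5) = qpoch j (5 * n + 4) * ?f (j * (5 * n + 5))"
      using qpoch_Suc [of j "5 * n"] qpoch_Suc [of j "5 * n + 1"] qpoch_Suc [of j "5 * n + 2"]
        qpoch_Suc [of j "5 * n + 3"] qpoch_Suc [of j "5 * n + 4"]
      by (simp_all only: Suc_eq_plus1 add.assoc one_add_one numeral_plus_one semiring_norm)
    moreover have "5 * Suc n = 5 * n + 5"
      by simp
    ultimately show ?thesis
      by (simp only: mult.assoc)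
  qed
  have dv: "\<not> 5 dvd 5 * n + 1" "\<not> 5 dvd 5 * n + 2" "\<not> 5 dvd 5 * n + 3" "\<not> 5 dvd 5 * n + 4"
    "5 dvd 5 * n + 5"
    by presburger+
  have "twist_norm w (qpoch 1 (5 * Suc n)) * twist 1 (qpoch 25 (Suc n))
    = (twist_norm w (qpoch 1 (5 * n)) * twist 1 (qpoch 25 n)) *
      (?f (5 * (5 * n + 1)) * ?f (5 * (5 * n + 2)) * ?f (5 * (5 * n + 3)) * ?f (5 * (5 * n + 4))
       * ?f (5 * n + 5) ^ 5 * ?f (25 * Suc n))"
    unfolding q qpoch_Suc [of 25] twist_norm_mult twist_mult tw mult_1 twist_norm_factor [OF w]
    using dv by (simp add: mult_ac)
  also have "\<dots> = twist 1 (qpoch 5 (5 * Suc n)) * twist 1 (qpoch 5 (Suc n)) ^ 5"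
  proof -
    have "25 * Suc n = 5 * (5 * n + 5)" "5 * n + 5 = 5 * Suc n"
      by simp_all
    then show ?thesis
      unfolding Suc.IH q qpoch_Suc [of 5 n] twist_mult tw by (simp only: power_mult_distrib mult_ac)
  qed
  finally show ?case .
qed

lemma twist_norm_E_1:
  assumes w: "1 + w + w ^ 2 + w ^ 3 + w ^ 4 = 0"
  shows "twist_norm w (E 1) * twist 1 (E 25) = twist 1 (E 5) ^ 6"
proof (rule fps_ext)
  fix n
  have "fps_agree n (twist_norm w (E 1) * twist 1 (E 25))
      (twist_norm w (qpoch 1 (5 * n)) * twist 1 (qpoch 25 n))"
    unfolding twist_norm_def
    by (intro fps_agree_mult fps_agree_twist fps_agree_sym [OF fps_agree_qpoch_E]) simp_all
  also have "fps_agree n \<dots> (twist 1 (E 5) * twist 1 (E 5) ^ 5)"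
    unfolding twist_norm_qpoch [OF w]
    by (intro fps_agree_mult fps_agree_power fps_agree_twist fps_agree_qpoch_E) simp_all
  finally show "(twist_norm w (E 1) * twist 1 (E 25)) $ n = (twist 1 (E 5) ^ 6) $ n"
    by (simp add: fps_agree_def power_Suc [symmetric] del: power_Suc)
qed

text \<open>With \<open>\<zeta> = E 1 / (X * E 25)\<close>, this is the modular equation
  \<open>E 5 ^ 6 / (X ^ 5 * E 25 ^ 6) = \<zeta>^5 + 5 \<zeta>^4 + 15 \<zeta>^3 + 25 \<zeta>^2 + 25 \<zeta>\<close>.\<close>

lemma E_modular_equation:
  defines "e \<equiv> E 1" and "b \<equiv> fps_X * E 25"
  shows "E 5 ^ 6 = E 25 * (e ^ 5 + 5 * e ^ 4 * b + 15 * e ^ 3 * b ^ 2 + 25 * e ^ 2 * b ^ 3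
      + 25 * e * b ^ 4)"
proof -
  obtain w :: complex where w: "1 + w + w ^ 2 + w ^ 3 + w ^ 4 = 0"
    using fifth_root_of_unity_exists by blast
  obtain a c where E1: "E 1 = dil a - fps_X * dil (E 5) + fps_X ^ 2 * dil c"
    and ac: "a * c = - (E 5 ^ 2)"
    by (rule E_1_dissection)
  define u where "u = fps_const w"
  have u: "1 + u + u ^ 2 + u ^ 3 + u ^ 4 = 0"
  proof -
    have "fps_const (1 + w + w ^ 2 + w ^ 3 + w ^ 4) = 0"
      using w by simp
    then show ?thesis
      by (simp add: u_def fps_const_power flip: fps_const_add fps_const_1_eq_1)
  qed
  define A B C where "A = twist 1 (dil a)" and "B = twist 1 b" and "C = twist 1 (fps_X ^ 2 * dil c)"
  \<comment> \<open>Series in \<open>X ^ 5\<close> are unchanged by the twist, so each part of the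
    dissection only acquires a power of \<open>u\<close>. The middle part is \<open>b\<close>, as
    \<open>dil (E 5) = E 25\<close>.\<close>
  have tw: "twist (w ^ k) (E 1) = A - u ^ k * B + u ^ (2 * k) * C" for k
  proof -
    have w5: "(w ^ k) ^ 5 = 1"
      using fifth_root_of_unity_reduce(1) [OF w] by (metis power_commutes power_mult power_one
          mult.commute)
    have x: "twist (w ^ k) fps_X = u ^ k * fps_X"
      by (simp add: twist_X u_def fps_const_power)
    have "twist (w ^ k) (fps_X * dil (E 5)) = u ^ k * B"
      using dil_E [of 5] twist_X [of 1] twist_dil [OF w5, of "E 5"]
      by (simp add: B_def b_def twist_mult x mult.assoc)
    moreover have "twist (w ^ k) (fps_X ^ 2 * dil c) = u ^ (2 * k) * C"
      unfolding power_even_eq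
      using twist_X [of 1] by (simp add: C_def twist_mult twist_power x power_mult_distrib
          mult.assoc twist_dil [OF w5])
    ultimately show ?thesis
      unfolding E1 twist_linear by (simp add: A_def twist_dil [OF w5])
  qed
  have AC: "A * C = - (B ^ 2)"
  proof -
    have "dil a * (fps_X ^ 2 * dil c) = fps_X ^ 2 * dil (a * c)"
      by (simp add: dil_hom mult_ac)
    also have "\<dots> = 0 - b ^ 2"
      unfolding ac b_def using dil_E [of 5] by (simp add: dil_hom power_mult_distrib)
    finally have "twist 1 (dil a * (fps_X ^ 2 * dil c)) = twist 1 (0 - b ^ 2)"
      by simp
    moreover have "twist 1 0 = 0"
      by (simp add: fps_eq_iff)
    ultimately show ?thesis
      unfolding A_def B_def C_def twist_linear twist_mult twist_power by simp
  qed
  have "twist 1 e = A - B + C"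
    using tw [of 0] by (simp add: e_def)
  note trinomial = fifth_root_of_unity_trinomial [OF u AC this]
  \<comment> \<open>The product of the conjugates is evaluated here through the dissection;
    \<open>twist_norm_E_1\<close> evaluates it through the infinite product.\<close>
  have "twist_norm w e = twist 1 e * (A - u * B + u ^ 2 * C) * (A - u ^ 2 * B + u ^ 4 * C) *
      (A - u ^ 3 * B + u ^ 6 * C) * (A - u ^ 4 * B + u ^ 8 * C)"
    unfolding twist_norm_def e_def using tw [of 1] tw [of 2] tw [of 3] tw [of 4] by simp
  also have "\<dots> = twist 1 e ^ 5 + 5 * twist 1 e ^ 4 * B + 15 * twist 1 e ^ 3 * B ^ 2
      + 25 * twist 1 e ^ 2 * B ^ 3 + 25 * twist 1 e * B ^ 4"
    by (rule trinomial)
  also have "\<dots> = twist 1 (e ^ 5 + 5 * e ^ 4 * b + 15 * e ^ 3 * b ^ 2 + 25 * e ^ 2 * b ^ 3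
      + 25 * e * b ^ 4)"
    by (simp add: B_def twist_linear twist_mult twist_power twist_numeral)
  finally show ?thesis
    using twist_norm_E_1 [OF w, folded e_def] by (intro twist_1_inj) (simp add: twist_mult
        twist_power mult.commute)
qed

section \<open>Extraction of exponents divisible by 5\<close>

text \<open>For \<open>k \<le> 4\<close>, \<open>\<zeta> ^ k\<close> is a Laurent polynomial in
  \<open>x\<close> with exponents between -4 and 4, so only its constant term survives: -1, -1, 5,
  -5 for \<open>k = 1, 2, 3, 4\<close>. The powers of \<open>X\<close> in front clear the
  denominators.\<close>

lemma sec_E_1_powers:
  "sec 0 (fps_X ^ 4 * E 1) = - (fps_X * E 5)"
  "sec 0 (fps_X ^ 3 * E 1 ^ 2) = - (fps_X * E 5 ^ 2)"
  "sec 0 (fps_X ^ 2 * E 1 ^ 3) = 5 * fps_X * E 5 ^ 3"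
  "sec 0 (fps_X * E 1 ^ 4) = - (5 * fps_X * E 5 ^ 4)"
proof -
  define b where "b = E 5"
  obtain a c where E: "E 1 = dil a - fps_X * dil b + fps_X ^ 2 * dil c" and ac: "a * c = - (b ^ 2)"
    unfolding b_def by (rule E_1_dissection)
  have sec: "sec 0 (fps_X ^ 0 * dil f0 + fps_X ^ 1 * dil f1 + fps_X ^ 2 * dil f2
      + fps_X ^ 3 * dil f3 + fps_X ^ 4 * dil f4) = f0" for f0 f1 f2 f3 f4 :: "rat fps"
    by (simp only: sec_linear sec_X_power_dil) simp
  have "fps_X ^ 4 * E 1 = fps_X ^ 0 * dil (- (fps_X * b)) + fps_X ^ 1 * dil (fps_X * c)
      + fps_X ^ 2 * dil 0 + fps_X ^ 3 * dil 0 + fps_X ^ 4 * dil a"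
    unfolding E dil_hom by algebra
  then show "sec 0 (fps_X ^ 4 * E 1) = - (fps_X * E 5)"
    unfolding b_def by (simp only: sec)
  have "fps_X ^ 3 * E 1 ^ 2 = fps_X ^ 0 * dil (fps_X * (b ^ 2 + 2 * (a * c)))
      + fps_X ^ 1 * dil (- (2 * fps_X * b * c)) + fps_X ^ 2 * dil (fps_X * c ^ 2)
          + fps_X ^ 3 * dil (a ^ 2) + fps_X ^ 4 * dil (- (2 * a * b))"
    unfolding E dil_hom by algebra
  then have "sec 0 (fps_X ^ 3 * E 1 ^ 2) = fps_X * (b ^ 2 + 2 * (a * c))"
    by (simp only: sec)
  then show "sec 0 (fps_X ^ 3 * E 1 ^ 2) = - (fps_X * E 5 ^ 2)"
    unfolding ac b_def by simp
  have "fps_X ^ 2 * E 1 ^ 3 = fps_X ^ 0 * dil (fps_X * (- (b ^ 3) - 6 * (a * c) * b))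
      + fps_X ^ 1 * dil (fps_X * (3 * b ^ 2 * c + 3 * a * c ^ 2))
      + fps_X ^ 2 * dil (a ^ 3 - 3 * fps_X * b * c ^ 2)
      + fps_X ^ 3 * dil (- (3 * a ^ 2 * b) + fps_X * c ^ 3)
      + fps_X ^ 4 * dil (3 * a * (a * c + b ^ 2))"
    unfolding E dil_hom by algebra
  then have "sec 0 (fps_X ^ 2 * E 1 ^ 3) = fps_X * (- (b ^ 3) - 6 * (a * c) * b)"
    by (simp only: sec)
  then show "sec 0 (fps_X ^ 2 * E 1 ^ 3) = 5 * fps_X * E 5 ^ 3"
    unfolding ac b_def by algebra
  have "fps_X * E 1 ^ 4 = fps_X ^ 0 * dil
      (fps_X * (6 * (a * c) ^ 2 + 12 * (a * c) * b ^ 2 + b ^ 4))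
          + fps_X ^ 1 * dil (a ^ 4 - fps_X * (4 * b ^ 3 * c + 12 * a * b * c ^ 2))
              + fps_X ^ 2 * dil (- (4 * a ^ 3 * b) + fps_X * (6 * b ^ 2 * c ^ 2 + 4 * a * c ^ 3))
                  + fps_X ^ 3 * dil (6 * a ^ 2 * b ^ 2 + 4 * a ^ 3 * c - fps_X * (4 * b * c ^ 3))
                      + fps_X ^ 4 * dil (- (4 * a * b ^ 3) - 12 * a ^ 2 * b * c + fps_X * c ^ 4)"
    unfolding E dil_hom by algebra
  then have "sec 0 (fps_X * E 1 ^ 4) = fps_X * (6 * (a * c) ^ 2 + 12 * (a * c) * b ^ 2 + b ^ 4)"
    by (simp only: sec)
  then show "sec 0 (fps_X * E 1 ^ 4) = - (5 * fps_X * E 5 ^ 4)"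
    unfolding ac b_def by algebra
qed

text \<open>This is \<open>1 / \<zeta>\<close>, a genuine power series.\<close>

definition Z :: "rat fps" where
  "Z = fps_X * E 25 * inverse (E 1)"

text \<open>\<open>dil T_inv\<close> is the reciprocal of
  \<open>E 5 ^ 6 / (X ^ 5 * E 25 ^ 6)\<close>, the product of the conjugates of
  \<open>\<zeta>\<close>.\<close>

definition T_inv :: "rat fps" where
  "T_inv = fps_X * (E 5 * inverse (E 1)) ^ 6"

lemma E_inverse: "j \<ge> 1 \<Longrightarrow> E j * inverse (E j) = 1"
  by (simp add: inverse_mult_eq_1')

lemma E_neq_0: "j \<ge> 1 \<Longrightarrow> E j \<noteq> 0"
  by (metis E_nth_0 fps_zero_nth zero_neq_one)

lemma E_1_mult_Z: "E 1 * Z = fps_X * E 25"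
  using E_inverse [of 1] by (simp add: Z_def mult_ac)

text \<open>In terms of \<open>\<zeta> = 1 / Z\<close> this is \<open>X ^ 5 * \<zeta> ^ (4 - m)\<close>; shifting the powers of \<open>\<zeta>\<close> by
  \<open>X ^ 5\<close> keeps the positive ones among the power series.\<close>

definition V :: "nat \<Rightarrow> rat fps" where
  "V m = fps_X * E 1 ^ 4 * inverse (E 25) ^ 4 * Z ^ m"

lemma V_add_4: "V (m + 4) = fps_X ^ 5 * Z ^ m"
proof -
  have "V (m + 4) = fps_X * (E 1 * Z) ^ 4 * inverse (E 25) ^ 4 * Z ^ m"
    by (simp add: V_def power_add power_mult_distrib mult_ac)
  also have "\<dots> = fps_X ^ 5 * (E 25 * inverse (E 25)) ^ 4 * Z ^ m"
    unfolding E_1_mult_Z by (simp add: power_mult_distrib mult_ac eval_nat_numeral)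
  finally show ?thesis
    by (simp add: E_inverse)
qed

lemma V_base:
  assumes "m + k = 4"
  shows "dil (E 5 ^ k) * V m = fps_X ^ (Suc m) * E 1 ^ k"
proof -
  have "E 25 ^ k * V m = fps_X * E 1 ^ k * (E 1 * Z) ^ m * inverse (E 25) ^ 4 * E 25 ^ k"
    unfolding V_def assms [symmetric] by (simp add: power_add power_mult_distrib mult_ac)
  also have "\<dots> = fps_X ^ Suc m * E 1 ^ k * (E 25 * inverse (E 25)) ^ 4"
    unfolding E_1_mult_Z assms [symmetric] by (simp add: power_add power_mult_distrib mult_ac)
  finally show ?thesis
    using dil_E [of 5] by (simp add: E_inverse dil_hom)
qed

text \<open>The numbers are the constant terms in \<open>x\<close> of \<open>\<zeta> ^ 4\<close>,
  ..., \<open>\<zeta> ^ 0\<close>; the factor \<open>fps_X\<close> is what \<open>X ^ 5\<close>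
  becomes under \<open>sec 0\<close>.\<close>

lemma sec_V_base:
  "sec 0 (V 0) = fps_X * (- 5)" "sec 0 (V 1) = fps_X * 5" "sec 0 (V 2) = fps_X * (- 1)"
  "sec 0 (V 3) = fps_X * (- 1)" "sec 0 (V 4) = fps_X * 1"
proof -
  have *: "sec 0 (V m) = f" if "m + k = 4" "sec 0 (fps_X ^ Suc m * E 1 ^ k) = E 5 ^ k * f" for m k f
  proof -
    have "E 5 ^ k * sec 0 (V m) = E 5 ^ k * f"
      using that(2) unfolding V_base [OF that(1), symmetric] by (simp add: sec_dil_mult)
    then show ?thesis
      using E_neq_0 [of 5] by simp
  qed
  show "sec 0 (V 0) = fps_X * (- 5)" "sec 0 (V 1) = fps_X * 5" "sec 0 (V 2) = fps_X * (- 1)"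
    "sec 0 (V 3) = fps_X * (- 1)"
    using sec_E_1_powers
    by (intro * [of 0 4] * [of 1 3] * [of 2 2] * [of 3 1]; simp add: eval_nat_numeral mult_ac)+
  have "sec 0 (fps_X ^ 0 * dil fps_X) = (fps_X :: rat fps)"
    by (simp only: sec_X_power_dil) simp
  then show "sec 0 (V 4) = fps_X * 1"
    using V_add_4 [of 0] by (simp add: dil_hom)
qed

text \<open>This is the modular equation divided by \<open>\<zeta> ^ Suc i\<close> and by the
  product of the conjugates. The \<open>X ^ 5\<close> in the reciprocal of that product is absorbed
  into the terms \<open>V\<close>.\<close>

lemma Z_power_eq:
  "Z ^ Suc i = dil ((E 5 * inverse (E 1)) ^ 6)
    * (V i + 5 * V (i + 1) + 15 * V (i + 2) + 25 * V (i + 3) + 25 * V (i + 4))"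
proof -
  define e b B I where "e = E 1" and "b = fps_X * E 25" and "B = E 25" and "I = inverse B"
  have eZ: "e * Z = b" and BI: "B * I = 1"
    using E_1_mult_Z E_inverse [of 25] by (simp_all add: e_def b_def B_def I_def)
  have X: "B ^ 6 * fps_X * I ^ 4 = B * b"
    using BI unfolding b_def B_def [symmetric] by algebra
  have "B ^ 6 * (V i + 5 * V (i + 1) + 15 * V (i + 2) + 25 * V (i + 3) + 25 * V (i + 4))
    = (B ^ 6 * fps_X * I ^ 4) * Z ^ i * (e ^ 4 + 5 * e ^ 4 * Z + 15 * e ^ 4 * Z ^ 2
        + 25 * e ^ 4 * Z ^ 3 + 25 * e ^ 4 * Z ^ 4)"
    unfolding V_def e_def B_def I_def power_add by algebra
  also have "\<dots> = B * Z ^ i *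
      (b * e ^ 4 + 5 * b * e ^ 4 * Z + 15 * b * e ^ 4 * Z ^ 2 + 25 * b * e ^ 4 * Z ^ 3
        + 25 * b * e ^ 4 * Z ^ 4)"
    unfolding X by algebra
  also have "b * e ^ 4 + 5 * b * e ^ 4 * Z + 15 * b * e ^ 4 * Z ^ 2 + 25 * b * e ^ 4 * Z ^ 3
        + 25 * b * e ^ 4 * Z ^ 4
      = Z * (e ^ 5 + 5 * e ^ 4 * b + 15 * e ^ 3 * b ^ 2 + 25 * e ^ 2 * b ^ 3 + 25 * e * b ^ 4)"
    unfolding eZ [symmetric] by algebra
  also have "B * Z ^ i * \<dots> = Z ^ Suc i * E 5 ^ 6"
    using E_modular_equation by (simp add: B_def e_def b_def)
  finally have "inverse (E 5) ^ 6 *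
      (B ^ 6 * (V i + 5 * V (i + 1) + 15 * V (i + 2) + 25 * V (i + 3) + 25 * V (i + 4)))
          = inverse (E 5) ^ 6 * (Z ^ Suc i * E 5 ^ 6)"
    by simp
  also have "\<dots> = Z ^ Suc i * (E 5 * inverse (E 5)) ^ 6"
    by (simp add: power_mult_distrib mult_ac)
  finally show ?thesis
    using dil_E [of 5] dil_E [of 1]
    by (simp add: E_inverse dil_hom dil_inverse B_def power_mult_distrib mult_ac)
qed

section \<open>Row generating functions of \<open>M\<close>\<close>

lemma M_eq_0: "j > i \<Longrightarrow> M i j = 0" "5 * j < i \<Longrightarrow> M i j = 0"
proof -
  have "(j > i \<longrightarrow> M i j = 0) \<and> (5 * j < i \<longrightarrow> M i j = 0)"
  proof (induction i arbitrary: j rule: less_induct)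
    case (less i)
    show ?case
    proof (cases "i \<le> 5")
      case True
      then consider "i = 0" | "i = 1" | "i = 2" | "i = 3" | "i = 4" | "i = 5"
        by linarith
      then show ?thesis
        by cases (auto simp: M.simps M_rows_def)
    next
      case False
      then have "M i j = (if j \<le> 1 then 0 else 25 * M (i - 1) (j - 1) + 25 * M (i - 2) (j - 1)
          + 15 * M (i - 3) (j - 1) + 5 * M (i - 4) (j - 1) + M (i - 5) (j - 1))"
        by (subst M.simps) auto
      \<comment> \<open>The recursion lowers the column by 1 and the row by between 1 and 5, which
        preserves both inequalities.\<close>
      moreover have "j - 1 > i - k" if "j > i" "1 \<le> k" "k \<le> 5" for k
        using that False by linarith
      moreover have "5 * (j - 1) < i - k" if "5 * j < i" "1 \<le> k" "k \<le> 5" "j > 1" for k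
        using that False by linarith
      ultimately show ?thesis
        using less.IH [of "i - 1" "j - 1"] less.IH [of "i - 2" "j - 1"] less.IH [of "i - 3" "j - 1"]
          less.IH [of "i - 4" "j - 1"] less.IH [of "i - 5" "j - 1"] False by auto
    qed
  qed
  then show "j > i \<Longrightarrow> M i j = 0" "5 * j < i \<Longrightarrow> M i j = 0"
    by auto
qed

definition M_gf :: "'a::comm_ring_1 \<Rightarrow> nat \<Rightarrow> 'a" where
  "M_gf t i = (\<Sum>j\<le>i. of_int (M i j) * t ^ j)"

lemma M_gf_bound:
  assumes "n \<ge> i"
  shows "M_gf t i = (\<Sum>j\<le>n. of_int (M i j) * t ^ j)"
  unfolding M_gf_def using assms by (intro sum.mono_neutral_left) (auto simp: M_eq_0)

lemma M_gf_base:
  "M_gf t 1 = 5 * t" "M_gf t 2 = 10 * t + 125 * t ^ 2" "M_gf t 3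
      = 9 * t + 375 * t ^ 2 + 3125 * t ^ 3"
  "M_gf t 4 = 4 * t + 550 * t ^ 2 + 12500 * t ^ 3 + 78125 * t ^ 4"
  "M_gf t 5 = t + 500 * t ^ 2 + 25000 * t ^ 3 + 390625 * t ^ 4 + 1953125 * t ^ 5"
  by (simp_all add: M_gf_def numeral_eq_Suc M.simps M_rows_def)

lemma M_gf_rec:
  "M_gf t (i + 6) = t * (M_gf t (i + 1) + 5 * M_gf t (i + 2) + 15 * M_gf t (i + 3)
      + 25 * M_gf t (i + 4)
    + 25 * M_gf t (i + 5))"
proof -
  have M0: "M k 0 = 0" for k
    by (simp add: M.simps)
  \<comment> \<open>Since column 0 is zero, the rule that column 1 vanishes from row 6 on becomes a
    case of the recursion.\<close>
  have M: "M (i + 6) (Suc j)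
      = 25 * M (i + 5) j + 25 * M (i + 4) j + 15 * M (i + 3) j + 5 * M (i + 2) j + M (i + 1) j"
          for j
    by (cases "j = 0") (simp_all add: M0 M.simps [of "i + 6"] add.commute)
  have "M_gf t (i + 6) = (\<Sum>j\<le>i + 5. of_int (M (i + 6) (Suc j)) * t ^ Suc j)"
    using sum.atMost_Suc_shift [of "\<lambda>j. of_int (M (i + 6) j) * t ^ j" "i + 5"]
    by (simp add: M_gf_def M0 add.commute del: power_Suc sum.atMost_Suc)
  also have "\<dots> = t * (25 * (\<Sum>j\<le>i + 5. of_int (M (i + 5) j) * t ^ j)
      + 25 * (\<Sum>j\<le>i + 5. of_int (M (i + 4) j) * t ^ j)
      + 15 * (\<Sum>j\<le>i + 5. of_int (M (i + 3) j) * t ^ j)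
      + 5 * (\<Sum>j\<le>i + 5. of_int (M (i + 2) j) * t ^ j)
      + (\<Sum>j\<le>i + 5. of_int (M (i + 1) j) * t ^ j))"
    unfolding M sum_distrib_left sum.distrib [symmetric]
    by (intro sum.cong refl) (simp add: algebra_simps)
  also have "\<dots> = t * (25 * M_gf t (i + 5) + 25 * M_gf t (i + 4) + 15 * M_gf t (i + 3)
      + 5 * M_gf t (i + 2) + M_gf t (i + 1))"
    by (simp only: M_gf_bound [of _ "i + 5"])
  finally show ?thesis
    by (simp add: algebra_simps)
qed

lemma sec_Z_power: "sec 0 (Z ^ Suc i) = M_gf T_inv (Suc i)"
proof -
  \<comment> \<open>\<open>W m\<close> stands for the extraction from
    \<open>\<zeta> ^ (4 - m)\<close>: the four positive powers supply initial values, and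
    \<open>W (i + 5)\<close> is the series sought.\<close>
  define W where "W m = (if m < 4 then [- 5, 5, - 1, - 1] ! m else sec 0 (Z ^ (m - 4)))" for m
  have V: "sec 0 (V m) = fps_X * W m" for m
  proof (cases "m < 4")
    case True
    then have "m = 0 \<or> m = 1 \<or> m = 2 \<or> m = 3"
      by linarith
    then show ?thesis
      using sec_V_base by (auto simp: W_def)
  next
    case False
    have "V m = dil fps_X * Z ^ (m - 4)"
      using V_add_4 [of "m - 4"] False by (simp add: dil_hom)
    then show ?thesis
      using False by (simp add: W_def sec_dil_mult)
  qed
  have rec: "W (i + 5) = T_inv *
      (W i + 5 * W (i + 1) + 15 * W (i + 2) + 25 * W (i + 3) + 25 * W (i + 4))" for i
  proof -
    have "W (i + 5) = sec 0 (Z ^ Suc i)"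
      by (simp add: W_def)
    also have "\<dots> = T_inv * (W i + 5 * W (i + 1) + 15 * W (i + 2) + 25 * W (i + 3) + 25 * W (i + 4))"
      unfolding Z_power_eq sec_dil_mult [OF zero_less_numeral] sec_linear V T_inv_def
      by (simp only: distrib_left distrib_right mult_ac)
    finally show ?thesis .
  qed
  have W4: "W 4 = 1"
    using V [of 4] sec_V_base(5) by simp
  have "W (i + 5) = M_gf T_inv (i + 1)"
  proof (induction i rule: less_induct)
    case (less i)
    have W: "W 0 = - 5" "W 1 = 5" "W 2 = - 1" "W 3 = - 1"
      by (simp_all add: W_def)
    \<comment> \<open>The first five rows of \<open>M\<close> follow one by one from these initial
      values; afterwards \<open>W\<close> and \<open>M_gf\<close> obey the same recursion.\<close>
    have "W 5 = T_inv * (W 0 + 5 * W 1 + 15 * W 2 + 25 * W 3 + 25 * W 4)"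
      using rec [of 0] by (simp del: One_nat_def add_2_eq_Suc add_2_eq_Suc')
    then have 0: "W 5 = M_gf T_inv 1"
      unfolding W W4 M_gf_base by (simp add: algebra_simps)
    have "W 6 = T_inv * (W 1 + 5 * W 2 + 15 * W 3 + 25 * W 4 + 25 * W 5)"
      using rec [of 1] by (simp del: One_nat_def add_2_eq_Suc add_2_eq_Suc')
    then have 1: "W 6 = M_gf T_inv 2"
      unfolding W W4 0 M_gf_base by algebra
    have "W 7 = T_inv * (W 2 + 5 * W 3 + 15 * W 4 + 25 * W 5 + 25 * W 6)"
      using rec [of 2] by (simp del: One_nat_def add_2_eq_Suc add_2_eq_Suc')
    then have 2: "W 7 = M_gf T_inv 3"
      unfolding W W4 0 1 M_gf_base by algebra
    have "W 8 = T_inv * (W 3 + 5 * W 4 + 15 * W 5 + 25 * W 6 + 25 * W 7)"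
      using rec [of 3] by (simp del: One_nat_def add_2_eq_Suc add_2_eq_Suc')
    then have 3: "W 8 = M_gf T_inv 4"
      unfolding W W4 0 1 2 M_gf_base by algebra
    have "W 9 = T_inv * (W 4 + 5 * W 5 + 15 * W 6 + 25 * W 7 + 25 * W 8)"
      using rec [of 4] by (simp del: One_nat_def add_2_eq_Suc add_2_eq_Suc')
    then have 4: "W 9 = M_gf T_inv 5"
      unfolding W W4 0 1 2 3 M_gf_base by algebra
    show ?case
    proof (cases "i < 5")
      case True
      then have "i = 0 \<or> i = 1 \<or> i = 2 \<or> i = 3 \<or> i = 4"
        by linarith
      then show ?thesis
        using 0 1 2 3 4 by (auto simp del: One_nat_def add_2_eq_Suc add_2_eq_Suc')
    next
      case False
      define k where "k = i - 5"
      have i: "i = k + 5"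
        using False by (simp add: k_def)
      have r: "W (k + 10) = T_inv *
          (W (k + 5) + 5 * W (k + 6) + 15 * W (k + 7) + 25 * W (k + 8) + 25 * W (k + 9))"
        using rec [of "k + 5"] by (simp add: ac_simps)
      have "W (k + 5) = M_gf T_inv (k + 1)" "W (k + 6) = M_gf T_inv (k + 2)"
        "W (k + 7) = M_gf T_inv (k + 3)" "W (k + 8) = M_gf T_inv (k + 4)"
        "W (k + 9) = M_gf T_inv (k + 5)"
        using less.IH [of k] less.IH [of "k + 1"] less.IH [of "k + 2"] less.IH [of "k + 3"]
          less.IH [of "k + 4"] i
        by (simp_all add: numeral_eq_Suc)
      then have "W (k + 10) = M_gf T_inv (k + 6)"
        unfolding r M_gf_rec by (simp only:)
      then show ?thesis
        by (simp add: i numeral_eq_Suc)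
    qed
  qed
  then show ?thesis
    by (simp add: W_def)
qed

text \<open>\<open>X / E 1\<close> equals \<open>Z / E 25\<close>, and
  \<open>E 25 = dil (E 5)\<close> is a scalar for the extraction.\<close>

lemma sec_power_quotient:
  "sec 0 (fps_X ^ Suc i * inverse (E 1) ^ Suc i * dil f)
      = f * inverse (E 5) ^ Suc i * M_gf T_inv (Suc i)"
proof -
  have "Z ^ Suc i * dil (inverse (E 5) ^ Suc i)
      = fps_X ^ Suc i * inverse (E 1) ^ Suc i * (E 25 * inverse (E 25)) ^ Suc i"
    using dil_E [of 5]
    unfolding Z_def by (simp only: dil_hom dil_inverse E_nth_0 power_mult_distrib)
      (simp add: mult_ac dil_hom dil_inverse)
  then have "fps_X ^ Suc i * inverse (E 1) ^ Suc i = Z ^ Suc i * dil (inverse (E 5) ^ Suc i)"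
    by (simp add: E_inverse)
  then have "fps_X ^ Suc i * inverse (E 1) ^ Suc i * dil f
      = dil (f * inverse (E 5) ^ Suc i) * Z ^ Suc i"
    by (simp only: dil_hom mult_ac)
  then show ?thesis
    by (simp only: sec_dil_mult zero_less_numeral sec_Z_power)
qed

section \<open>One extraction step\<close>

lemma E_power_cancel:
  assumes "j \<ge> 1"
  shows "E j ^ (m + k) * inverse (E j) ^ m = E j ^ k"
    and "E j ^ m * inverse (E j) ^ (m + k) = inverse (E j) ^ k"
proof -
  have "E j ^ m * inverse (E j) ^ m = 1"
    using E_inverse [OF assms] by (simp flip: power_mult_distrib)
  then show "E j ^ (m + k) * inverse (E j) ^ m = E j ^ k"
    and "E j ^ m * inverse (E j) ^ (m + k) = inverse (E j) ^ k"
    by (simp_all add: power_add mult_ac)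
qed

lemma sec_quotient:
  assumes d: "1 \<le> d" "d \<le> 5" and q: "q \<le> 6" and K: "5 * p + d \<le> K"
  shows "sec 0 (fps_X ^ (p + d) * (E 5 ^ (6 * p + q) * inverse (E 1) ^ (6 * p + d)))
    = (\<Sum>k\<in>{1..K}. of_int (M (6 * p + d) (p + k)) *
        (fps_X ^ k * (E 5 ^ (6 * k - d) * inverse (E 1) ^ (6 * k - q))))"
    (is "?L = (\<Sum>k\<in>_. ?R k)")
proof -
  define n where "n = 6 * p + d"
  define e g e' g' where "e = E 1" and "g = E 5" and "e' = inverse e" and "g' = inverse g"
  \<comment> \<open>The factor turns into \<open>X ^ (5 * p)\<close> under \<open>sec 0\<close>,
    raising the power of \<open>X\<close> to \<open>6 * p + d\<close>, the exponent of
    \<open>inverse (E 1)\<close>.\<close>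
  have "fps_X ^ p * ?L = sec 0
      (dil (fps_X ^ p) * (fps_X ^ (p + d) * (E 5 ^ (6 * p + q) * inverse (E 1) ^ (6 * p + d))))"
    by (simp add: sec_dil_mult)
  also have "dil (fps_X ^ p) *
      (fps_X ^ (p + d) * (E 5 ^ (6 * p + q) * inverse (E 1) ^ (6 * p + d)))
      = fps_X ^ n * inverse (E 1) ^ n * dil (E 1 ^ (6 * p + q))"
    using dil_E [of 1] by (simp add: dil_hom n_def mult_ac flip: power_mult power_add)
  also have "sec 0 \<dots> = E 1 ^ (6 * p + q) * inverse (E 5) ^ n * M_gf T_inv n"
    using sec_power_quotient [of "n - 1"] d by (simp add: n_def)
  also have "M_gf T_inv n = (\<Sum>j\<le>p + K. of_int (M n j) * T_inv ^ j)"
    using K by (intro M_gf_bound) (simp add: n_def)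
  \<comment> \<open>Columns \<open>j \<le> p\<close> vanish because
    \<open>5 * p < n\<close>.\<close>
  also have "\<dots> = (\<Sum>j\<in>{p + 1..p + K}. of_int (M n j) * T_inv ^ j)"
  proof (intro sum.mono_neutral_right ballI)
    fix j
    assume "j \<in> {..p + K} - {p + 1..p + K}"
    then have "M n j = 0"
      using d by (intro M_eq_0(2)) (auto simp: n_def)
    then show "of_int (M n j) * T_inv ^ j = 0"
      by simp
  qed auto
  also have "\<dots> = (\<Sum>k\<in>{1..K}. of_int (M n (p + k)) * T_inv ^ (p + k))"
    using sum.shift_bounds_cl_nat_ivl [of _ 1 p K] by (simp add: add.commute)
  finally have "fps_X ^ p * ?L
      = (\<Sum>k\<in>{1..K}. of_int (M n (p + k)) * (e ^ (6 * p + q) * g' ^ n * T_inv ^ (p + k)))"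
    by (simp add: sum_distrib_left e_def g'_def g_def mult_ac)
  also have "\<dots> = (\<Sum>k\<in>{1..K}. fps_X ^ p * ?R k)"
  proof (intro sum.cong refl)
    fix k
    assume "k \<in> {1..K}"
    then have k: "6 * (p + k) = 6 * p + q + (6 * k - q)" "6 * (p + k) = n + (6 * k - d)"
      using d q by (auto simp: n_def)
    have "e ^ (6 * p + q) * g' ^ n * T_inv ^ (p + k)
      = fps_X ^ (p + k) * (e ^ (6 * p + q) * e' ^ (6 * (p + k))) * (g ^ (6 * (p + k)) * g' ^ n)"
      by (simp add: T_inv_def e_def g_def e'_def power_mult_distrib mult_ac flip: power_mult)
    also have "e ^ (6 * p + q) * e' ^ (6 * (p + k)) = e' ^ (6 * k - q)"
      unfolding k(1) e_def e'_def by (rule E_power_cancel) simp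
    also have "g ^ (6 * (p + k)) * g' ^ n = g ^ (6 * k - d)"
      unfolding k(2) g_def g'_def by (rule E_power_cancel) simp
    finally show "of_int (M n (p + k)) * (e ^ (6 * p + q) * g' ^ n * T_inv ^ (p + k))
        = fps_X ^ p * ?R k"
      by (simp add: n_def e_def e'_def g_def power_add mult_ac)
  qed
  also have "\<dots> = fps_X ^ p * (\<Sum>k\<in>{1..K}. ?R k)"
    by (simp add: sum_distrib_left)
  finally show ?thesis
    by simp
qed

lemma fps_X_mult_sec:
  assumes "1 \<le> d" "d \<le> 5"
  shows "fps_X * sec (5 - d) f = sec 0 (fps_X ^ d * f)"
proof (rule fps_ext)
  fix n
  show "(fps_X * sec (5 - d) f) $ n = sec 0 (fps_X ^ d * f) $ n"
  proof (cases n)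
    case 0
    then show ?thesis
      using assms by (simp add: fps_X_power_mult_nth)
  next
    case (Suc m)
    have "5 * Suc m - d = 5 * m + (5 - d)" "\<not> 5 * Suc m < d"
      using assms by simp_all
    then show ?thesis
      unfolding Suc by (simp only: sec_nth add_0_right fps_X_power_mult_nth if_False) simp
  qed
qed

text \<open>Both transitions are instances: \<open>d = 2\<close>, \<open>q = 5\<close> leads from
  odd to even \<alpha>, and \<open>d = 1\<close>, \<open>q = 4\<close> from even to odd. The bound
  \<open>6 * K\<close> suffices as \<open>5 * (i - 1) + d \<le> 5 * K\<close> for
  \<open>i \<le> K\<close>.\<close>

lemma sec_step:
  fixes x :: "nat \<Rightarrow> int"
  assumes d: "1 \<le> d" "d \<le> 5" and q: "q \<le> 6"
  shows "sec (5 - d) (\<Sum>i\<in>{1..K}. of_int (x i) *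
      (fps_X ^ (i - 1) * (E 5 ^ (6 * (i - 1) + q) * inverse (E 1) ^ (6 * (i - 1) + d))))
    = (\<Sum>k\<in>{1..6 * K}. of_int (\<Sum>i\<in>{1..K}. x i * M (6 * (i - 1) + d) (i - 1 + k)) *
        (fps_X ^ (k - 1) * (E 5 ^ (6 * k - d) * inverse (E 1) ^ (6 * k - q))))"
    (is "sec _ ?F = ?G")
proof -
  define R where "R k = E 5 ^ (6 * k - d) * inverse (E 1) ^ (6 * k - q)" for k
  have "fps_X * sec (5 - d) ?F = sec 0 (fps_X ^ d * ?F)"
    by (rule fps_X_mult_sec [OF d])
  also have "\<dots> = (\<Sum>i\<in>{1..K}. of_int (x i) * sec 0
      (fps_X ^ (i - 1 + d) * (E 5 ^ (6 * (i - 1) + q) * inverse (E 1) ^ (6 * (i - 1) + d))))"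
    unfolding sum_distrib_left sec_linear
    by (intro sum.cong refl) (simp only: sec_linear [symmetric] power_add mult_ac)
  also have "\<dots> = (\<Sum>i\<in>{1..K}. of_int (x i) *
      (\<Sum>k\<in>{1..6 * K}. of_int (M (6 * (i - 1) + d) (i - 1 + k)) * (fps_X ^ k * R k)))"
    unfolding R_def using d q by (intro sum.cong refl arg_cong2 [of _ _ _ _ "(*)"] sec_quotient)
      auto
  also have "\<dots> = (\<Sum>k\<in>{1..6 * K}. of_int (\<Sum>i\<in>{1..K}. x i * M (6 * (i - 1) + d) (i - 1 + k)) *
      (fps_X ^ k * R k))"
    unfolding sum_distrib_left of_int_sum sum_distrib_right
    by (subst sum.swap) (simp add: mult.assoc)
  also have "\<dots> = (\<Sum>k\<in>{1..6 * K}. fps_X *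
      (of_int (\<Sum>i\<in>{1..K}. x i * M (6 * (i - 1) + d) (i - 1 + k)) * (fps_X ^ (k - 1) * R k)))"
  proof (intro sum.cong refl)
    fix k
    assume "k \<in> {1..6 * K}"
    then have "(fps_X :: rat fps) ^ k = fps_X * fps_X ^ (k - 1)"
      by (cases k) auto
    then show "of_int (\<Sum>i\<in>{1..K}. x i * M (6 * (i - 1) + d) (i - 1 + k)) * (fps_X ^ k * R k)
      = fps_X * (of_int (\<Sum>i\<in>{1..K}. x i * M (6 * (i - 1) + d) (i - 1 + k))
          * (fps_X ^ (k - 1) * R k))"
      by (simp only: mult_ac)
  qed
  also have "\<dots> = fps_X * ?G"
    by (simp only: sum_distrib_left R_def)
  finally show ?thesis
    by simp
qed

section \<open>Induction on \<alpha>\<close>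

lemma vec_mat_mult_finite:
  assumes "\<And>i. i > K \<Longrightarrow> v i = 0"
  shows "vec_mat_mult v A j = (\<Sum>i\<in>{1..K}. v i * A i j)"
proof -
  have "vec_mat_mult v A j = (\<Sum>\<^sub>\<infinity>i\<in>{1..K}. v i * A i j)"
    unfolding vec_mat_mult_def using assms by (intro infsum_cong_neutral) auto
  then show ?thesis
    by simp
qed

lemma delta_tilde_Suc: "delta_tilde (Suc \<alpha>) = 5 ^ \<alpha> * (if odd \<alpha> then 3 else 4) + delta_tilde \<alpha>"
proof -
  have "real (delta_tilde (Suc \<alpha>)) = real (5 ^ \<alpha> * (if odd \<alpha> then 3 else 4) + delta_tilde \<alpha>)"
    using delta_tilde_odd [of \<alpha>] delta_tilde_even [of \<alpha>] delta_tilde_odd [of "Suc \<alpha>"]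
      delta_tilde_even [of "Suc \<alpha>"]
    by (cases "odd \<alpha>") (simp_all add: field_simps)
  then show ?thesis
    by (simp only: of_nat_eq_iff)
qed

lemma sec_progression:
  "sec (if odd \<alpha> then 3 else 4) (Abs_fps (\<lambda>n. f (5 ^ \<alpha> * n + delta_tilde \<alpha>)))
    = Abs_fps (\<lambda>n. f (5 ^ Suc \<alpha> * n + delta_tilde (Suc \<alpha>)))"
proof -
  have "5 ^ \<alpha> * (5 * n + r) + d = 5 ^ Suc \<alpha> * n + (5 ^ \<alpha> * r + d)"
      for n r d :: nat
    by (simp add: algebra_simps)
  then show ?thesis
    unfolding delta_tilde_Suc by (simp only: fps_eq_iff sec_nth fps_nth_Abs_fps) simp
qed

text \<open>Finite support is carried through the induction because it turns the infinite sum in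
  \<open>vec_mat_mult\<close> into a finite one.\<close>

lemma x_tilde_expansion:
  fixes c :: "nat \<Rightarrow> int"
  assumes c: "Abs_fps (\<lambda>n. of_int (c n)) = E 5 ^ 4 / E 1" and "\<alpha> \<ge> 1"
  shows "\<exists>K. (\<forall>i>K. x_tilde \<alpha> i = 0) \<and> Abs_fps (\<lambda>n. of_int (c (5 ^ \<alpha> * n + delta_tilde \<alpha>)))
    = (\<Sum>i\<in>{1..K}. of_int (x_tilde \<alpha> i) * (fps_X ^ (i - 1) *
        (E 5 ^ (6 * i - (if odd \<alpha> then 1 else 2)) *
          inverse (E 1) ^ (6 * i - (if odd \<alpha> then 4 else 5)))))"
  using \<open>\<alpha> \<ge> 1\<close>
proof (induction \<alpha> rule: nat_induct_at_least)
  case base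
  \<comment> \<open>The case \<open>\<alpha> = 1\<close> is itself an extraction step, from
    \<open>E 5 ^ 4 / E 1\<close> with the one-entry vector 1; it produces the first row of
    \<open>M\<close>.\<close>
  have "delta_tilde 0 = 0"
    by (simp add: delta_tilde_def)
  then have "Abs_fps (\<lambda>n. of_int (c (5 ^ 1 * n + delta_tilde 1))) = sec 4 (E 5 ^ 4 / E 1)"
    using sec_progression [of 0 "\<lambda>n. of_int (c n) :: rat"] by (simp add: c [simplified])
  also have "E 5 ^ 4 / E 1 =
      (\<Sum>i\<in>{1..1}. of_int 1 * (fps_X ^ (i - 1) *
          (E 5 ^ (6 * (i - 1) + 4) * inverse (E 1) ^ (6 * (i - 1) + 1))))"
    by (simp add: fps_divide_unit)
  also have "sec 4 \<dots> = (\<Sum>k\<in>{1..6 * 1}. of_int (\<Sum>i\<in>{1..1}. 1 * M (6 * (i - 1) + 1) (i - 1 + k)) *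
      (fps_X ^ (k - 1) * (E 5 ^ (6 * k - 1) * inverse (E 1) ^ (6 * k - 4))))"
    using sec_step [of 1 4 "\<lambda>i. 1" 1] by (simp only: le_refl) simp
  also have "\<dots> = (\<Sum>k\<in>{1..6}. of_int (x_tilde 1 k) *
      (fps_X ^ (k - 1) * (E 5 ^ (6 * k - 1) * inverse (E 1) ^ (6 * k - 4))))"
  proof (intro sum.cong arg_cong2 [of _ _ _ _ "(*)"] arg_cong [of _ _ of_int] refl)
    fix k :: nat
    assume "k \<in> {1..6}"
    then show "(\<Sum>i\<in>{1..1}. 1 * M (6 * (i - 1) + 1) (i - 1 + k)) = x_tilde 1 k"
      by (cases "k = 1") (simp_all add: M_eq_0 M.simps [of "Suc 0" "Suc 0"] M_rows_def)
  qed simp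
  finally show ?case
    by (intro exI [of _ 6]) simp
next
  case (Suc \<alpha>)
  \<comment> \<open>\<open>5 - d\<close> is the residue 3 or 4 by which \<open>delta_tilde\<close>
    grows, and \<open>6 * (i - 1) + d\<close> is the row of \<open>M\<close> used in
    \<open>a_tilde\<close> or \<open>b_tilde\<close>.\<close>
  define d q :: nat where "d = (if odd \<alpha> then 2 else 1)" and "q = (if odd \<alpha> then 5 else 4)"
  from Suc.IH obtain K where K: "\<And>i. i > K \<Longrightarrow> x_tilde \<alpha> i = 0"
    and IH: "Abs_fps (\<lambda>n. of_int (c (5 ^ \<alpha> * n + delta_tilde \<alpha>)))
    = (\<Sum>i\<in>{1..K}. of_int (x_tilde \<alpha> i) * (fps_X ^ (i - 1) *
        (E 5 ^ (6 * i - (if odd \<alpha> then 1 else 2)) *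
          inverse (E 1) ^ (6 * i - (if odd \<alpha> then 4 else 5)))))"
    by blast
  have x: "x_tilde (Suc \<alpha>) k = (\<Sum>i\<in>{1..K}. x_tilde \<alpha> i * M (6 * (i - 1) + d) (i - 1 + k))"
    if "k \<ge> 1" for k
  proof -
    from Suc.hyps have "x_tilde (Suc \<alpha>)
        = vec_mat_mult (x_tilde \<alpha>) (if odd \<alpha> then a_tilde else b_tilde)"
      by (cases \<alpha>) simp_all
    then have "x_tilde (Suc \<alpha>) k
        = (\<Sum>i\<in>{1..K}. x_tilde \<alpha> i * (if odd \<alpha> then a_tilde else b_tilde) i k)"
      using vec_mat_mult_finite [OF K] by simp
    moreover have "(if odd \<alpha> then a_tilde else b_tilde) i k = M (6 * (i - 1) + d) (i - 1 + k)"
      if "i \<in> {1..K}" for i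
    proof -
      have "6 * i - 4 = 6 * (i - 1) + 2" "6 * i - 5 = 6 * (i - 1) + 1"
        using that by auto
      then show ?thesis
        using that \<open>k \<ge> 1\<close> by (simp add: a_tilde_def b_tilde_def d_def)
    qed
    ultimately show ?thesis
      by simp
  qed
  have supp: "x_tilde (Suc \<alpha>) k = 0" if "k > 6 * K" for k
    using that unfolding d_def by (subst x) (auto intro!: sum.neutral M_eq_0(1) simp: d_def)
  have "(Abs_fps (\<lambda>n. of_int (c (5 ^ Suc \<alpha> * n + delta_tilde (Suc \<alpha>)))) :: rat fps)
    = sec (5 - d) (Abs_fps (\<lambda>n. of_int (c (5 ^ \<alpha> * n + delta_tilde \<alpha>))))"
    using sec_progression [of \<alpha> "\<lambda>n. of_int (c n) :: rat"]
    by (cases "odd \<alpha>") (simp_all add: d_def)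
  also have "Abs_fps (\<lambda>n. of_int (c (5 ^ \<alpha> * n + delta_tilde \<alpha>)))
    = (\<Sum>i\<in>{1..K}. of_int (x_tilde \<alpha> i) * (fps_X ^ (i - 1) *
        (E 5 ^ (6 * (i - 1) + q) * inverse (E 1) ^ (6 * (i - 1) + d))))"
    unfolding IH
  proof (intro sum.cong refl)
    fix i
    assume "i \<in> {1..K}"
    then have "6 * i - (if odd \<alpha> then 1 else 2) = 6 * (i - 1) + q"
      "6 * i - (if odd \<alpha> then 4 else 5) = 6 * (i - 1) + d"
      by (auto simp: d_def q_def)
    then show "of_int (x_tilde \<alpha> i) *
        (fps_X ^ (i - 1) * (E 5 ^ (6 * i - (if odd \<alpha> then 1 else 2)) *
          inverse (E 1) ^ (6 * i - (if odd \<alpha> then 4 else 5))))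
      = of_int (x_tilde \<alpha> i) * (fps_X ^ (i - 1) *
        (E 5 ^ (6 * (i - 1) + q) * inverse (E 1) ^ (6 * (i - 1) + d)))"
      by (simp only:)
  qed
  also have "sec (5 - d) \<dots> =
      (\<Sum>k\<in>{1..6 * K}. of_int (\<Sum>i\<in>{1..K}. x_tilde \<alpha> i * M (6 * (i - 1) + d) (i - 1 + k)) *
        (fps_X ^ (k - 1) * (E 5 ^ (6 * k - d) * inverse (E 1) ^ (6 * k - q))))"
    by (rule sec_step) (simp_all add: d_def q_def)
  also have "\<dots> = (\<Sum>k\<in>{1..6 * K}. of_int (x_tilde (Suc \<alpha>) k) *
        (fps_X ^ (k - 1) * (E 5 ^ (6 * k - d) * inverse (E 1) ^ (6 * k - q))))"
    by (intro sum.cong refl) (simp add: x)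
  finally show ?case
    using supp by (intro exI [of _ "6 * K"]) (auto simp: d_def q_def)
qed

theorem theorem1p2:
  fixes c :: "nat \<Rightarrow> int" and \<alpha> :: nat
  assumes c: "Abs_fps (\<lambda>n. of_int (c n)) = E 5 ^ 4 / E 1"
    and \<alpha>: "\<alpha> \<ge> 1"
  shows "(odd \<alpha> \<longrightarrow>
      ((\<lambda>i. fps_const (of_int (x_tilde \<alpha> i)) * fps_X ^ (i - 1)
             * (E 5 ^ (6 * i - 1) / E 1 ^ (6 * i - 4)))
        has_sum Abs_fps (\<lambda>n. of_int (c (5 ^ \<alpha> * n + delta_tilde \<alpha>)))) {1..})
    \<and> (even \<alpha> \<longrightarrow>
      ((\<lambda>i. fps_const (of_int (x_tilde \<alpha> i)) * fps_X ^ (i - 1)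
             * (E 5 ^ (6 * i - 2) / E 1 ^ (6 * i - 5)))
        has_sum Abs_fps (\<lambda>n. of_int (c (5 ^ \<alpha> * n + delta_tilde \<alpha>)))) {1..})"
proof -
  obtain K where K: "\<And>i. i > K \<Longrightarrow> x_tilde \<alpha> i = 0"
    and eq: "Abs_fps (\<lambda>n. of_int (c (5 ^ \<alpha> * n + delta_tilde \<alpha>)))
    = (\<Sum>i\<in>{1..K}. of_int (x_tilde \<alpha> i) * (fps_X ^ (i - 1) *
        (E 5 ^ (6 * i - (if odd \<alpha> then 1 else 2)) *
          inverse (E 1) ^ (6 * i - (if odd \<alpha> then 4 else 5)))))"
    using x_tilde_expansion [OF c \<alpha>] by blast
  have quot: "f / E 1 ^ m = f * inverse (E 1) ^ m" for f m
    by (simp add: fps_divide_unit fps_inverse_power)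
  \<comment> \<open>Summands beyond \<open>K\<close> vanish, so the infinite sum has the finite sum
    as its value.\<close>
  show ?thesis
    using K unfolding eq quot fps_of_int
    by (intro conjI impI has_sum_finite_neutralI [of "{1..K}"]) (auto simp: mult.assoc)
qed

end
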